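(* Let $(K,c)\in\mathcal{D}_1$. Then there exists $\mu_b=\mu_b(K,c)\in\mathbb{R}$ such that the system (S) has a solution $(u,w)$ on $\mathbb{R}$ with $$u(-\infty)=u_1,\quad u(\infty)=u_2,\quad w(\pm\infty)=0,\quad w>0$$ if and only if $\mu=\mu_b$. Likewise, there exists $\mu_f=\mu_f(K,c)\in\mathbb{R}$ such that (S) has a solution $(u,w)$ on $\mathbb{R}$ with $$u(-\infty)=u_2,\quad u(\infty)=u_1,\quad w(\pm\infty)=0,\quad w<0$$ if and only if $\mu=\mu_f$.
   Context: Standing assumptions. $\tau>0$ is a constant. $V\in C^1([0,\infty))\cap C^2((0,\infty))$; $V'(u)$ is positive and bounded for $u>0$ and $V'(u)\to0$ as $u\to\infty$; there is a global maximum point $U_M\in(0,\infty)$ of $V'$ such that $u=U_M$ is the unique root of $V''(u)=0$. $\kappa\in C^1((0,\infty))$ with $\kappa>0$. System (S). For $K\in\mathbb{R}\setminus\{0\}$ and $c,\mu\in\mathbb{R}$ ($\mu$ is treated as an independent parameter), consider $$u_z=w,\qquad w_z=g_1(u)f(u)+g_2(u)h(u,\mu)w,\tag{S}$$ where $f(u)=\frac{Ku-V(u)-c}{K}$, $h(u,\mu)=f'(u)+\mu$, $g_1(u)=\frac{1}{\tau\kappa(u^{-1})}$, $g_2(u)=\frac{u}{2\tau\kappa(u^{-1})}$. Only solutions with $u(z)>0$ for all $z$ are considered. $w(\pm\infty)$, $u(\pm\infty)$ denote limits as $z\to\pm\infty$. Parameter set. $K_0=V'(0)$, $K_M=V'(U_M)>K_0$.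 For $K\in(K_0,K_M)$ the function $u\mapsto Ku-V(u)$ has a unique local maximum point $u_M=u_M(K)\in(0,U_M)$, and for $K\in(0,K_M)$ it has a unique local minimum point $u_m=u_m(K)\in(U_M,\infty)$. Put $c_0=-V(0)$, $c_M(K)=Ku_M-V(u_M)$, $c_m(K)=Ku_m-V(u_m)$, $c_1(K)=\max\{c_0,c_m(K)\}$, and $$\mathcal{D}_1=\{(K,c): K_0<K<K_M,\ c_1(K)<c<c_M(K)\}.$$ For $(K,c)\in\mathcal{D}_1$ the function $f$ has exactly three zeros in $(0,\infty)$, denoted $u_1,u_0,u_2$ with $0<u_1<u_0<u_2$. *)

theory Defs
  imports "HOL-Analysis.Analysis"
begin

definition f_fun :: "(real \<Rightarrow> real) \<Rightarrow> real \<Rightarrow> real \<Rightarrow> real \<Rightarrow> real" where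
  "f_fun V K c u = (K * u - V u - c) / K"

definition h_fun :: "(real \<Rightarrow> real) \<Rightarrow> real \<Rightarrow> real \<Rightarrow> real \<Rightarrow> real \<Rightarrow> real" where
  "h_fun V K c \<mu> u = deriv (f_fun V K c) u + \<mu>"

definition g1_fun :: "real \<Rightarrow> (real \<Rightarrow> real) \<Rightarrow> real \<Rightarrow> real" where
  "g1_fun \<tau> \<kappa> u = 1 / (\<tau> * \<kappa> (inverse u))"

definition g2_fun :: "real \<Rightarrow> (real \<Rightarrow> real) \<Rightarrow> real \<Rightarrow> real" where
  "g2_fun \<tau> \<kappa> u = u / (2 * \<tau> * \<kappa> (inverse u))"

definition solves_S ::
  "real \<Rightarrow> (real \<Rightarrow> real) \<Rightarrow> (real \<Rightarrow> real) \<Rightarrow> real \<Rightarrow> real \<Rightarrow> real \<Rightarrow> (real \<Rightarrow> real) \<Rightarrow> (real \<Rightarrow> real) \<Rightarrow> bool"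
where
  "solves_S \<tau> \<kappa> V K c \<mu> u w \<longleftrightarrow>
     (\<forall>z. u z > 0 \<and>
          (u has_real_derivative w z) (at z) \<and>
          (w has_real_derivative
             g1_fun \<tau> \<kappa> (u z) * f_fun V K c (u z)
             + g2_fun \<tau> \<kappa> (u z) * h_fun V K c \<mu> (u z) * w z) (at z))"

definition local_max_point :: "(real \<Rightarrow> real) \<Rightarrow> real \<Rightarrow> bool" where
  "local_max_point \<phi> x \<longleftrightarrow> (\<forall>\<^sub>F y in nhds x. \<phi> y \<le> \<phi> x)"

definition local_min_point :: "(real \<Rightarrow> real) \<Rightarrow> real \<Rightarrow> bool" where
  "local_min_point \<phi> x \<longleftrightarrow> (\<forall>\<^sub>F y in nhds x. \<phi> x \<le> \<phi> y)"

text \<open>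
  Local extrema are taken over the open half-line. The boundary point 0 is excluded: for
  \<open>K > V' 0\<close> it is a one-sided local minimum of \<open>\<lambda>u. K * u - V u\<close> on \<open>{0..}\<close>, so it would
  destroy the uniqueness of \<open>u_min\<close>. The uniqueness that makes \<open>u_max\<close> meaningful holds
  for \<open>K\<close> between \<open>V' 0\<close> and the maximum of \<open>V'\<close>.
\<close>

definition u_max :: "(real \<Rightarrow> real) \<Rightarrow> real \<Rightarrow> real" where
  "u_max V K = (THE x. x > 0 \<and> local_max_point (\<lambda>u. K * u - V u) x)"

definition u_min :: "(real \<Rightarrow> real) \<Rightarrow> real \<Rightarrow> real" where
  "u_min V K = (THE x. x > 0 \<and> local_min_point (\<lambda>u. K * u - V u) x)"

definition c_zero :: "(real \<Rightarrow> real) \<Rightarrow> real" where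
  "c_zero V = - V 0"

definition c_max :: "(real \<Rightarrow> real) \<Rightarrow> real \<Rightarrow> real" where
  "c_max V K = K * u_max V K - V (u_max V K)"

definition c_min :: "(real \<Rightarrow> real) \<Rightarrow> real \<Rightarrow> real" where
  "c_min V K = K * u_min V K - V (u_min V K)"

definition c_one :: "(real \<Rightarrow> real) \<Rightarrow> real \<Rightarrow> real" where
  "c_one V K = max (c_zero V) (c_min V K)"

text \<open>\<open>V'\<close> is passed explicitly, since its value at 0 is a one-sided derivative.\<close>

definition D1 :: "(real \<Rightarrow> real) \<Rightarrow> (real \<Rightarrow> real) \<Rightarrow> real \<Rightarrow> (real \<times> real) set" where
  "D1 V V' U\<^sub>M = {(K, c). V' 0 < K \<and> K < V' U\<^sub>M \<and> c_one V K < c \<and> c < c_max V K}"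

definition three_zeros :: "(real \<Rightarrow> real) \<Rightarrow> real \<Rightarrow> real \<Rightarrow> real \<Rightarrow> real \<Rightarrow> real \<Rightarrow> bool" where
  "three_zeros V K c x\<^sub>1 x\<^sub>0 x\<^sub>2 \<longleftrightarrow>
     0 < x\<^sub>1 \<and> x\<^sub>1 < x\<^sub>0 \<and> x\<^sub>0 < x\<^sub>2 \<and> {u. u > 0 \<and> f_fun V K c u = 0} = {x\<^sub>1, x\<^sub>0, x\<^sub>2}"

definition u_one :: "(real \<Rightarrow> real) \<Rightarrow> real \<Rightarrow> real \<Rightarrow> real" where
  "u_one V K c = (THE x\<^sub>1. \<exists>x\<^sub>0 x\<^sub>2. three_zeros V K c x\<^sub>1 x\<^sub>0 x\<^sub>2)"

definition u_two :: "(real \<Rightarrow> real) \<Rightarrow> real \<Rightarrow> real \<Rightarrow> real" where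
  "u_two V K c = (THE x\<^sub>2. \<exists>x\<^sub>1 x\<^sub>0. three_zeros V K c x\<^sub>1 x\<^sub>0 x\<^sub>2)"

end

theory Submission
  imports Defs
begin

text \<open>
  Along an orbit with \<open>w > 0\<close> the component \<open>u\<close> increases strictly, so \<open>w\<close> is a function \<open>p\<close> of \<open>u\<close>. Write
  \<open>G = g\<^sub>1 f\<close>, \<open>A = g\<^sub>2 f'\<close> and \<open>B = g\<^sub>2\<close>. Heteroclinic orbits from \<open>u\<^sub>1\<close> to \<open>u\<^sub>2\<close> correspond to positive
  solutions on \<open>(u\<^sub>1, u\<^sub>2)\<close> of the scalar equation \<open>p' = A + \<mu> B + G / p\<close> that vanish at both ends
  (lemma \<open>heteroclinic_iff_connection\<close>). To get from \<open>p\<close> back to an orbit on the whole line, one needs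
  that the time \<open>\<integral> du / p\<close> diverges at both ends. It does, because \<open>G\<close> is differentiable at its zeros
  \<open>u\<^sub>1\<close> and \<open>u\<^sub>2\<close>, which forces \<open>p\<close> to be at most linear there.

  On \<open>(u\<^sub>1, u\<^sub>0)\<close>, where \<open>G > 0\<close>, the right-hand side decreases in \<open>p\<close>. Hence solutions with
  \<open>p(u\<^sub>1) = 0\<close> are ordered in the same way as their coefficients, and for each \<open>\<mu>\<close> there is exactly one
  (lemmas \<open>branch_mono\<close> and \<open>branch_exists\<close>). This takes the place of the unstable manifold of the
  saddle \<open>(u\<^sub>1, 0)\<close>. Its height \<open>\<alpha> \<mu>\<close> at \<open>u\<^sub>0\<close> is nondecreasing, Lipschitz and unbounded in \<open>\<mu>\<close>. The
  reflection \<open>u \<mapsto> - u\<close> brings the interval \<open>(u\<^sub>0, u\<^sub>2)\<close>, where \<open>G < 0\<close>, into the same form with \<open>- \<mu>\<close> in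
  place of \<open>\<mu>\<close>, and gives a height \<open>\<beta> (- \<mu>)\<close> that is nonincreasing in \<open>\<mu>\<close>. By the intermediate value
  theorem the two heights agree for some \<open>\<mu>\<close>. Their common value is positive because
  \<open>G'(u\<^sub>0) < 0\<close> (lemma \<open>branch_end_pos\<close>), and so the halves fit together to a solution. Two parameters
  \<open>\<mu>1 < \<mu>2\<close> cannot both work: the second curve would be above the first one before \<open>u\<^sub>0\<close> and below it
  after \<open>u\<^sub>0\<close>, yet steeper at \<open>u\<^sub>0\<close> (theorem \<open>unique_connection_parameter\<close>).

  An orbit with \<open>w < 0\<close> from \<open>u\<^sub>2\<close> to \<open>u\<^sub>1\<close> becomes, after \<open>z \<mapsto> - z\<close> and \<open>w \<mapsto> - w\<close>, an orbit of the first
  kind with \<open>- A\<close> and \<open>- \<mu>\<close> in place of \<open>A\<close> and \<open>\<mu>\<close>, so the same theorem applies to it.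
\<close>

section \<open>Comparison and global solvability of scalar equations\<close>

text \<open>
  All comparisons below have this form: a difference \<open>\<phi>\<close> of a solution and a competitor starts
  nonnegative, and wherever it is negative the equation pushes it back up. After the last point at
  which \<open>\<phi>\<close> is nonnegative it would be negative and nondecreasing, which is absurd.
\<close>
lemma nonneg_of_barrier:
  fixes \<phi> :: "real \<Rightarrow> real"
  assumes cont: "continuous_on {s..t} \<phi>" and start: "0 \<le> \<phi> s" and x: "x \<in> {s..t}"
    and push: "\<And>u. s < u \<Longrightarrow> u < t \<Longrightarrow> \<phi> u < 0 \<Longrightarrow> \<exists>D\<ge>0. (\<phi> has_real_derivative D) (at u)"
  shows "0 \<le> \<phi> x"
proof (rule ccontr)
  assume neg: "\<not> 0 \<le> \<phi> x"
  define S where "S = {u \<in> {s..x}. 0 \<le> \<phi> u}"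
  have cx: "continuous_on {s..x} \<phi>"
    by (rule continuous_on_subset[OF cont]) (use x in auto)
  have "closed S"
    unfolding S_def by (intro continuous_on_closed_Collect_le continuous_on_const cx) auto
  moreover have "s \<in> S" using start x by (auto simp: S_def)
  moreover have bdd: "bdd_above S" by (auto simp: S_def)
  ultimately have rS: "Sup S \<in> S" using closed_contains_Sup by blast
  define r where "r = Sup S"
  have r: "s \<le> r" "r \<le> x" "0 \<le> \<phi> r" using rS by (auto simp: S_def r_def)
  with neg have "r < x" by (cases "r = x") auto
  have below: "\<phi> u < 0" if "r < u" "u \<le> x" for u
  proof (rule ccontr)
    assume "\<not> \<phi> u < 0"
    with that r have "u \<in> S" by (auto simp: S_def)
    then have "u \<le> r" unfolding r_def using bdd by (rule cSup_upper)
    with that show False by simp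
  qed
  have "\<phi> r \<le> \<phi> x"
  proof (rule DERIV_nonneg_imp_increasing_open[where f=\<phi>])
    show "continuous_on {r..x} \<phi>" by (rule continuous_on_subset[OF cx]) (use r in auto)
    fix u assume "r < u" "u < x"
    then show "\<exists>y. (\<phi> has_real_derivative y) (at u) \<and> 0 \<le> y"
      using push[of u] below[of u] r x by auto
  qed (use r in auto)
  with r neg show False by linarith
qed

text \<open>
  Picard's theorem on a whole compact interval for a right-hand side that is Lipschitz in the
  unknown. With the substitution \<open>p u = W u * f u\<close>, \<open>W u = exp (2 * L * (u - a))\<close> (Bielecki's weight),
  the integral operator is a contraction with constant \<open>1/2\<close> in the supremum norm, whatever the
  length of the interval.
\<close>
lemma picard_global:
  fixes \<Phi> :: "real \<Rightarrow> real \<Rightarrow> real"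
  assumes ab: "a \<le> b" and L: "L > 0"
    and cont: "\<And>y. continuous_on {a..b} y \<Longrightarrow> continuous_on {a..b} (\<lambda>s. \<Phi> s (y s))"
    and lip: "\<And>s x y. s \<in> {a..b} \<Longrightarrow> \<bar>\<Phi> s x - \<Phi> s y\<bar> \<le> L * \<bar>x - y\<bar>"
  obtains p where "p a = y0"
    and "\<And>u. u \<in> {a..b} \<Longrightarrow> (p has_real_derivative \<Phi> u (p u)) (at u within {a..b})"
proof -
  define W where "W s = exp (2 * L * (s - a))" for s
  have Wpos: "W s > 0" for s by (simp add: W_def)
  define I where "I f u = y0 + integral {a..u} (\<lambda>s. \<Phi> s (W s * f s))" for f :: "real \<Rightarrow> real" and u
  \<comment> \<open>Clamping the argument to the interval turns functions on it into bounded continuous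
    functions on the line, which form a complete metric space.\<close>
  define J where "J f x = (let u = max a (min b x) in I f u / W u)" for f :: "real \<Rightarrow> real" and x
  define T where "T f = Bcontfun (J (apply_bcontfun f))" for f :: "real \<Rightarrow>\<^sub>C real"
  have cW: "continuous_on A W" for A unfolding W_def by (intro continuous_intros)
  have cint: "continuous_on {a..b} (\<lambda>s. \<Phi> s (W s * f s))" if "continuous_on {a..b} f" for f
    by (rule cont) (intro continuous_on_mult cW that)
  have cI: "continuous_on {a..b} (I f)" if "continuous_on {a..b} f" for f
    unfolding I_def
    by (intro continuous_on_add continuous_on_const indefinite_integral_continuous_1
        integrable_continuous_real cint that)
  have clamp: "max a (min b x) \<in> {a..b}" for x using ab by auto
  have cJ: "J f \<in> bcontfun" if f: "continuous_on {a..b} f" for f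
  proof -
    have c: "continuous_on {a..b} (\<lambda>u. I f u / W u)"
      using Wpos by (intro continuous_on_divide cI f cW) (metis less_irrefl)
    have c1: "continuous_on UNIV (J f)"
      unfolding J_def Let_def
      by (rule continuous_on_compose2[OF c]) (use clamp in \<open>auto intro!: continuous_intros\<close>)
    have "bounded ((\<lambda>u. I f u / W u) ` {a..b})"
      by (intro compact_imp_bounded compact_continuous_image c) auto
    then have "bounded (range (J f))"
      by (rule bounded_subset) (use clamp in \<open>auto simp: J_def Let_def\<close>)
    with c1 show ?thesis by (simp add: bcontfun_def)
  qed
  have TJ: "apply_bcontfun (T f) = J f" for f
    unfolding T_def by (rule Bcontfun_inverse) (intro cJ continuous_on_apply_bcontfun)
  have contr: "dist (T f) (T g) \<le> (1/2) * dist f g" for f g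
  proof (rule dist_bound)
    fix x
    define u where "u = max a (min b x)"
    define d where "d = dist f g"
    have u: "u \<in> {a..b}" using clamp unfolding u_def .
    have sub: "continuous_on {a..u} (\<lambda>s. \<Phi> s (W s * f s))" for f :: "real \<Rightarrow>\<^sub>C real"
      by (rule continuous_on_subset[OF cint]) (use u in auto)
    have hW: "((\<lambda>s. L * W s * d) has_integral (W u * d / 2 - W a * d / 2)) {a..u}"
      by (rule fundamental_theorem_of_calculus)
        (use u in \<open>auto simp: W_def has_real_derivative_iff_has_vector_derivative[symmetric]
          intro!: derivative_eq_intros\<close>)
    have "I f u - I g u = integral {a..u} (\<lambda>s. \<Phi> s (W s * f s) - \<Phi> s (W s * g s))"
      unfolding I_def by (simp add: Henstock_Kurzweil_Integration.integral_diff integrable_continuous_real sub)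
    also have "\<bar>\<dots>\<bar> \<le> integral {a..u} (\<lambda>s. L * W s * d)"
      unfolding real_norm_def[symmetric]
    proof (rule integral_norm_bound_integral)
      show "(\<lambda>s. \<Phi> s (W s * f s) - \<Phi> s (W s * g s)) integrable_on {a..u}"
        by (intro integrable_continuous_real continuous_on_diff sub)
      show "(\<lambda>s. L * W s * d) integrable_on {a..u}" using hW by blast
      fix s assume s: "s \<in> {a..u}"
      have "\<bar>\<Phi> s (W s * f s) - \<Phi> s (W s * g s)\<bar> \<le> L * \<bar>W s * f s - W s * g s\<bar>"
        by (rule lip) (use s u in auto)
      also have "\<bar>W s * f s - W s * g s\<bar> = W s * dist (f s) (g s)"
        using Wpos[of s] by (simp add: dist_real_def abs_mult right_diff_distrib[symmetric])
      also have "L * (W s * dist (f s) (g s)) \<le> L * (W s * d)"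
        unfolding d_def using L Wpos[of s] by (intro mult_left_mono dist_bounded) auto
      finally show "norm (\<Phi> s (W s * f s) - \<Phi> s (W s * g s)) \<le> L * W s * d" by simp
    qed
    also have "\<dots> = W u * d / 2 - W a * d / 2" using hW by (rule integral_unique)
    also have "\<dots> \<le> W u * d / 2" using Wpos[of a] by (simp add: d_def)
    finally have "\<bar>I f u - I g u\<bar> / W u \<le> (1/2) * d"
      using Wpos[of u] by (simp add: field_simps)
    moreover have "dist (J f x) (J g x) = \<bar>I f u - I g u\<bar> / W u"
      using Wpos[of u] by (simp add: J_def Let_def u_def[symmetric] dist_real_def
          diff_divide_distrib[symmetric] abs_divide)
    ultimately show "dist (T f x) (T g x) \<le> (1/2) * dist f g" by (simp add: TJ d_def)
  qed
  have "\<exists>!f\<in>UNIV. T f = f"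
    by (rule Banach_fix[where c="1/2"]) (use contr complete_UNIV in auto)
  then obtain f where f: "T f = f" by blast
  define p where "p = I f"
  have fp: "W u * f u = p u" if "u \<in> {a..b}" for u
  proof -
    have "f u = J f u" using TJ[of f] f by simp
    then show ?thesis using that Wpos[of u] by (auto simp: J_def Let_def p_def max_absorb2 min_absorb2)
  qed
  show ?thesis
  proof
    show "p a = y0" by (simp add: p_def I_def)
    fix u assume u: "u \<in> {a..b}"
    have "(I f has_real_derivative 0 + \<Phi> u (W u * f u)) (at u within {a..b})"
      unfolding I_def
      by (intro DERIV_add DERIV_const integral_has_real_derivative cint continuous_on_apply_bcontfun u)
    then show "(p has_real_derivative \<Phi> u (p u)) (at u within {a..b})"
      using fp[OF u] by (simp add: p_def)
  qed
qed

section \<open>Phase curves leaving an equilibrium\<close>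

text \<open>
  The part of a phase curve \<open>w = p u\<close> that leaves the equilibrium \<open>(a, 0)\<close>: dividing
  \<open>w' = G u + F u * w\<close> by \<open>u' = w\<close> gives \<open>p' = F + G / p\<close>. At the right end \<open>m\<close> only continuity is
  required, since \<open>p m\<close> may be zero.
\<close>
definition branch :: "(real \<Rightarrow> real) \<Rightarrow> (real \<Rightarrow> real) \<Rightarrow> real \<Rightarrow> real \<Rightarrow> (real \<Rightarrow> real) \<Rightarrow> bool" where
  "branch F G a m p \<longleftrightarrow> continuous_on {a..m} p \<and> p a = 0 \<and>
     (\<forall>u. a < u \<longrightarrow> u < m \<longrightarrow> 0 < p u \<and> (p has_real_derivative F u + G u / p u) (at u))"

lemma branchD:
  assumes "branch F G a m p"
  shows "continuous_on {a..m} p" "p a = 0"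
    "\<And>u. a < u \<Longrightarrow> u < m \<Longrightarrow> 0 < p u"
    "\<And>u. a < u \<Longrightarrow> u < m \<Longrightarrow> (p has_real_derivative F u + G u / p u) (at u)"
  using assms by (auto simp: branch_def)

text \<open>
  Since \<open>G \<ge> 0\<close>, the term \<open>G / p\<close> decreases with \<open>p\<close>: where \<open>p2\<close> lies below \<open>p1\<close> it grows at least
  as fast, so it can never have fallen below. With \<open>F1 = F2\<close> this is uniqueness of the branch, in
  spite of the singularity at \<open>a\<close>.
\<close>
lemma branch_mono:
  assumes p1: "branch F1 G a m p1" and p2: "branch F2 G a m p2"
    and G: "\<And>u. a < u \<Longrightarrow> u < m \<Longrightarrow> 0 \<le> G u"
    and F: "\<And>u. a < u \<Longrightarrow> u < m \<Longrightarrow> F1 u \<le> F2 u"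
    and u: "u \<in> {a..m}"
  shows "p1 u \<le> p2 u"
proof -
  have "0 \<le> p2 u - p1 u"
  proof (rule nonneg_of_barrier[OF _ _ u])
    show "continuous_on {a..m} (\<lambda>u. p2 u - p1 u)"
      by (intro continuous_on_diff branchD[OF p1] branchD[OF p2])
    show "0 \<le> p2 a - p1 a" using branchD(2)[OF p1] branchD(2)[OF p2] by simp
    fix u assume u: "a < u" "u < m" and neg: "p2 u - p1 u < 0"
    have "G u / p1 u \<le> G u / p2 u"
      using neg G[OF u] branchD(3)[OF p2 u] by (intro divide_left_mono) (auto intro: mult_pos_pos)
    with F[OF u] have "0 \<le> (F2 u + G u / p2 u) - (F1 u + G u / p1 u)" by simp
    then show "\<exists>D\<ge>0. ((\<lambda>u. p2 u - p1 u) has_real_derivative D) (at u)"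
      using DERIV_diff[OF branchD(4)[OF p2 u] branchD(4)[OF p1 u]] by blast
  qed
  then show ?thesis by simp
qed

text \<open>
  The ordering of the two branches makes \<open>G / p2 - G / p1\<close> nonpositive, so the gap grows no faster
  than the difference of the coefficients. This gives continuity in the parameter, although
  \<open>G / p\<close> is not Lipschitz in \<open>p\<close> near the equilibrium.
\<close>
lemma branch_gap:
  assumes p1: "branch F1 G a m p1" and p2: "branch F2 G a m p2"
    and G: "\<And>u. a < u \<Longrightarrow> u < m \<Longrightarrow> 0 \<le> G u"
    and F: "\<And>u. a < u \<Longrightarrow> u < m \<Longrightarrow> F1 u \<le> F2 u"
    and C: "\<And>u. a < u \<Longrightarrow> u < m \<Longrightarrow> F2 u - F1 u \<le> C"
    and u: "u \<in> {a..m}"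
  shows "p2 u - p1 u \<le> C * (u - a)"
proof -
  have "0 \<le> C * (u - a) - (p2 u - p1 u)"
  proof (rule nonneg_of_barrier[OF _ _ u])
    show "continuous_on {a..m} (\<lambda>u. C * (u - a) - (p2 u - p1 u))"
      by (intro continuous_intros branchD[OF p1] branchD[OF p2])
    show "0 \<le> C * (a - a) - (p2 a - p1 a)" using branchD(2)[OF p1] branchD(2)[OF p2] by simp
    fix u assume u: "a < u" "u < m"
    have le: "p1 u \<le> p2 u" by (rule branch_mono[OF p1 p2 G F]) (use u in auto)
    have "G u / p2 u \<le> G u / p1 u"
      using le G[OF u] branchD(3)[OF p1 u] branchD(3)[OF p2 u] by (intro divide_left_mono) (auto intro: mult_pos_pos)
    with C[OF u] have "0 \<le> C * (1 - 0) - ((F2 u + G u / p2 u) - (F1 u + G u / p1 u))" by simp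
    moreover have "((\<lambda>u. C * (u - a) - (p2 u - p1 u)) has_real_derivative
        C * (1 - 0) - ((F2 u + G u / p2 u) - (F1 u + G u / p1 u))) (at u)"
      by (intro DERIV_diff DERIV_cmult DERIV_ident DERIV_const branchD(4)[OF p1 u] branchD(4)[OF p2 u])
    ultimately show "\<exists>D\<ge>0. ((\<lambda>u. C * (u - a) - (p2 u - p1 u)) has_real_derivative D) (at u)"
      by blast
  qed
  then show ?thesis by simp
qed

lemma branch_ge_linear:
  assumes p: "branch F G a m p"
    and G: "\<And>u. a < u \<Longrightarrow> u < m \<Longrightarrow> 0 \<le> G u"
    and F: "\<And>u. a < u \<Longrightarrow> u < m \<Longrightarrow> k \<le> F u"
    and u: "u \<in> {a..m}"
  shows "k * (u - a) \<le> p u"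
proof -
  have "0 \<le> p u - k * (u - a)"
  proof (rule nonneg_of_barrier[OF _ _ u])
    show "continuous_on {a..m} (\<lambda>u. p u - k * (u - a))"
      by (intro continuous_intros branchD[OF p])
    show "0 \<le> p a - k * (a - a)" using branchD(2)[OF p] by simp
    fix u assume u: "a < u" "u < m"
    have "0 \<le> F u + G u / p u - k * (1 - 0)"
      using F[OF u] divide_nonneg_pos[OF G[OF u] branchD(3)[OF p u]] by simp
    moreover have "((\<lambda>u. p u - k * (u - a)) has_real_derivative F u + G u / p u - k * (1 - 0)) (at u)"
      by (intro DERIV_diff DERIV_cmult DERIV_ident DERIV_const branchD(4)[OF p u])
    ultimately show "\<exists>D\<ge>0. ((\<lambda>u. p u - k * (u - a)) has_real_derivative D) (at u)" by blast
  qed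
  then show ?thesis by simp
qed

text \<open>
  The line \<open>y = (C + L + 1) * d\<close> is a supersolution of \<open>p' = F + G / p\<close> when \<open>F \<le> C\<close> and
  \<open>G \<le> L * d\<close>: on and above it \<open>G / p\<close> contributes at most \<open>L\<close> to the slope.
\<close>
lemma slope_budget:
  fixes C L d y g :: real
  assumes "0 \<le> C" "0 \<le> L" "0 < d" "g \<le> L * d" "(C + L + 1) * d \<le> y" 
  shows "g / y \<le> L"
proof -
  have "d \<le> (C + L + 1) * d" using assms by (simp add: mult_le_cancel_right1)
  with assms have "d \<le> y" "0 < y" by linarith+
  have "g \<le> L * y" using assms(2,4) \<open>d \<le> y\<close> by (meson mult_left_mono order_trans)
  with \<open>0 < y\<close> show ?thesis by (simp add: divide_le_eq)
qed

text \<open>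
  Because of this bound the time \<open>\<integral> du / p\<close> spent near the equilibrium is infinite: the orbit leaves it
  only as \<open>z\<close> comes from \<open>- \<infinity>\<close>.
\<close>
lemma branch_le_linear:
  assumes p: "branch F G a m p" and C0: "0 \<le> C" and L0: "0 \<le> L"
    and G: "\<And>u. a < u \<Longrightarrow> u < m \<Longrightarrow> G u \<le> L * (u - a)"
    and F: "\<And>u. a < u \<Longrightarrow> u < m \<Longrightarrow> F u \<le> C"
    and u: "u \<in> {a..m}"
  shows "p u \<le> (C + L + 1) * (u - a)"
proof -
  let ?M = "C + L + 1"
  have "0 \<le> ?M * (u - a) - p u"
  proof (rule nonneg_of_barrier[OF _ _ u])
    show "continuous_on {a..m} (\<lambda>u. ?M * (u - a) - p u)"
      by (intro continuous_intros branchD[OF p])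
    show "0 \<le> ?M * (a - a) - p a" using branchD(2)[OF p] by simp
    fix u assume u: "a < u" "u < m" and neg: "?M * (u - a) - p u < 0"
    have "G u / p u \<le> L"
      by (rule slope_budget[OF C0 L0 _ G[OF u]]) (use u neg in auto)
    then have "0 \<le> ?M * (1 - 0) - (F u + G u / p u)" using F[OF u] by simp
    moreover have "((\<lambda>u. ?M * (u - a) - p u) has_real_derivative ?M * (1 - 0) - (F u + G u / p u)) (at u)"
      by (intro DERIV_diff DERIV_cmult DERIV_ident DERIV_const branchD(4)[OF p u])
    ultimately show "\<exists>D\<ge>0. ((\<lambda>u. ?M * (u - a) - p u) has_real_derivative D) (at u)" by blast
  qed
  then show ?thesis by simp
qed

text \<open>
  Replacing \<open>p\<close> by \<open>max p e\<close> in the denominator makes the equation globally Lipschitz, while keeping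
  the right-hand side nonincreasing in \<open>p\<close> when \<open>G \<ge> 0\<close>.
\<close>
lemma regularised_branch_exists:
  assumes am: "a \<le> m" and F: "continuous_on {a..m} F" and G: "continuous_on {a..m} G" and e: "0 < e"
  obtains p where "continuous_on {a..m} p" "p a = 0"
    "\<And>u. a < u \<Longrightarrow> u < m \<Longrightarrow> (p has_real_derivative F u + G u / max (p u) e) (at u)"
proof -
  have "bounded (G ` {a..m})" by (intro compact_imp_bounded compact_continuous_image G) auto
  then obtain B where B: "0 < B" "\<And>s. s \<in> {a..m} \<Longrightarrow> \<bar>G s\<bar> \<le> B"
    unfolding bounded_pos by auto
  have lip: "\<bar>(F s + G s / max x e) - (F s + G s / max y e)\<bar> \<le> B / (e * e) * \<bar>x - y\<bar>"
    if s: "s \<in> {a..m}" for s x y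
  proof -
    let ?x = "max x e" and ?y = "max y e"
    have pos: "e \<le> ?x" "e \<le> ?y" "0 < ?x" "0 < ?y" using e by auto
    have "(F s + G s / ?x) - (F s + G s / ?y) = G s * (?y - ?x) / (?x * ?y)"
      using pos by (simp add: field_simps)
    then have "\<bar>(F s + G s / ?x) - (F s + G s / ?y)\<bar> = \<bar>G s\<bar> * \<bar>?y - ?x\<bar> / (?x * ?y)"
      using pos by (simp add: abs_mult)
    also have "\<dots> \<le> B * \<bar>x - y\<bar> / (e * e)"
      using B s pos e by (intro frac_le mult_mono) (auto simp: max_def)
    finally show ?thesis by simp
  qed
  obtain p where p: "p a = 0" "\<And>u. u \<in> {a..m} \<Longrightarrow>
      (p has_real_derivative F u + G u / max (p u) e) (at u within {a..m})"
  proof (rule picard_global[OF am, of "B / (e * e)" "\<lambda>u y. F u + G u / max y e" 0])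
    show "0 < B / (e * e)" using B e by simp
    show "continuous_on {a..m} (\<lambda>s. F s + G s / max (y s) e)" if "continuous_on {a..m} y" for y
      using that e by (intro continuous_intros F G) (auto simp: max_def)
  qed (use lip in auto)
  show ?thesis
  proof
    show "continuous_on {a..m} p" using p(2) by (rule DERIV_continuous_on)
    show "(p has_real_derivative F u + G u / max (p u) e) (at u)" if "a < u" "u < m" for u
      using p(2)[of u] that by (simp add: at_within_Icc_at)
  qed (rule p(1))
qed

text \<open>
  The regularised solutions \<open>P n\<close> with \<open>e n = 1 / (n + 1)\<close> increase with \<open>n\<close>, because a smaller cut-off
  means a larger drift, and they stay below a line through \<open>(a, 0)\<close>; so they have a limit \<open>p\<close>. The limit is
  positive inside because \<open>G\<close> is bounded below by a positive constant on compact parts of \<open>(a, m)\<close>,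
  which makes the drift arbitrarily large at small heights. On such a part the cut-off is eventually
  inactive, and dominated convergence in the integrated equation shows that \<open>p\<close> solves the
  singular equation.
\<close>
lemma branch_exists:
  assumes am: "a < m" and F: "continuous_on {a..m} F" and G: "continuous_on {a..m} G"
    and Gpos: "\<And>u. a < u \<Longrightarrow> u < m \<Longrightarrow> 0 < G u"
    and L0: "0 \<le> L" and GL: "\<And>u. a < u \<Longrightarrow> u < m \<Longrightarrow> G u \<le> L * (u - a)"
  obtains p where "branch F G a m p"
proof -
  have "bounded (F ` {a..m})" by (intro compact_imp_bounded compact_continuous_image F) auto
  then obtain C where C: "0 < C" "\<And>s. s \<in> {a..m} \<Longrightarrow> \<bar>F s\<bar> \<le> C"
    unfolding bounded_pos by auto
  define e where "e n = inverse (real (Suc n))" for n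
  have e0: "0 < e n" for n by (simp add: e_def)
  have e_dec: "e k \<le> e n" if "n \<le> k" for n k using that by (simp add: e_def)
  have e_lim: "e \<longlonglongrightarrow> 0" unfolding e_def by (rule LIMSEQ_inverse_real_of_nat)
  have "\<exists>p. continuous_on {a..m} p \<and> p a = 0 \<and> (\<forall>u. a < u \<longrightarrow> u < m \<longrightarrow>
      (p has_real_derivative F u + G u / max (p u) (e n)) (at u))" for n
    using regularised_branch_exists[OF less_imp_le[OF am] F G e0[of n]] by metis
  then obtain P where Pc: "\<And>n. continuous_on {a..m} (P n)" and Pa: "\<And>n. P n a = 0"
    and Pd: "\<And>n u. a < u \<Longrightarrow> u < m \<Longrightarrow>
      (P n has_real_derivative F u + G u / max (P n u) (e n)) (at u)"
    by metis
  have mx: "0 < max (P n u) (e n)" for n u using e0[of n] by (simp add: less_max_iff_disj)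
  have Fb: "F u \<le> C" "- C \<le> F u" if "u \<in> {a..m}" for u using C(2)[OF that] by auto
  have P_mono: "P n u \<le> P k u" if nk: "n \<le> k" and u: "u \<in> {a..m}" for n k u
  proof -
    have "0 \<le> P k u - P n u"
    proof (rule nonneg_of_barrier[OF _ _ u])
      show "continuous_on {a..m} (\<lambda>u. P k u - P n u)" by (intro continuous_on_diff Pc)
      fix u assume u: "a < u" "u < m" and neg: "P k u - P n u < 0"
      have "G u / max (P n u) (e n) \<le> G u / max (P k u) (e k)"
        using neg Gpos[OF u] e_dec[OF nk] mx[of n u] mx[of k u]
        by (intro divide_left_mono) (auto intro: mult_pos_pos)
      then have "0 \<le> (F u + G u / max (P k u) (e k)) - (F u + G u / max (P n u) (e n))" by simp
      then show "\<exists>D\<ge>0. ((\<lambda>u. P k u - P n u) has_real_derivative D) (at u)"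
        using DERIV_diff[OF Pd[OF u] Pd[OF u]] by blast
    qed (simp add: Pa)
    then show ?thesis by simp
  qed
  let ?M = "C + L + 1"
  have P_upper: "P n u \<le> ?M * (u - a)" if u: "u \<in> {a..m}" for n u
  proof -
    have "0 \<le> ?M * (u - a) - P n u"
    proof (rule nonneg_of_barrier[OF _ _ u])
      show "continuous_on {a..m} (\<lambda>u. ?M * (u - a) - P n u)" by (intro continuous_intros Pc)
      fix u assume u: "a < u" "u < m" and neg: "?M * (u - a) - P n u < 0"
      have "G u / max (P n u) (e n) \<le> L"
        by (rule slope_budget[OF less_imp_le[OF C(1)] L0 _ GL[OF u]]) (use u neg in auto)
      then have "0 \<le> ?M * (1 - 0) - (F u + G u / max (P n u) (e n))" using Fb(1)[of u] u by simp
      moreover have "((\<lambda>u. ?M * (u - a) - P n u) has_real_derivative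
          ?M * (1 - 0) - (F u + G u / max (P n u) (e n))) (at u)"
        by (intro DERIV_diff DERIV_cmult DERIV_ident DERIV_const Pd u)
      ultimately show "\<exists>D\<ge>0. ((\<lambda>u. ?M * (u - a) - P n u) has_real_derivative D) (at u)" by blast
    qed (simp add: Pa)
    then show ?thesis by simp
  qed
  have P_slope: "P n s - C * (u - s) \<le> P n u" if s: "a \<le> s" and su: "s \<le> u" and um: "u \<le> m" for n s u
  proof -
    have "0 \<le> P n u - P n s + C * (u - s)"
    proof (rule nonneg_of_barrier[where s=s and t=m and x=u])
      show "continuous_on {s..m} (\<lambda>u. P n u - P n s + C * (u - s))"
        using s by (intro continuous_intros continuous_on_subset[OF Pc]) auto
      fix u assume u: "s < u" "u < m"
      with s have u': "a < u" by simp
      have "0 \<le> F u + G u / max (P n u) (e n) - 0 + C * (1 - 0)"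
        using Fb(2)[of u] u u' divide_pos_pos[OF Gpos[OF u' u(2)] mx[of n u]] by simp
      moreover have "((\<lambda>u. P n u - P n s + C * (u - s)) has_real_derivative
          F u + G u / max (P n u) (e n) - 0 + C * (1 - 0)) (at u)"
        by (intro DERIV_add DERIV_diff DERIV_cmult DERIV_ident DERIV_const Pd u u')
      ultimately show "\<exists>D\<ge>0. ((\<lambda>u. P n u - P n s + C * (u - s)) has_real_derivative D) (at u)" by blast
    qed (use s su um in auto)
    then show ?thesis by simp
  qed
  define p where "p u = lim (\<lambda>n. P n u)" for u
  have P_lim: "(\<lambda>n. P n u) \<longlonglongrightarrow> p u" if u: "u \<in> {a..m}" for u
  proof -
    have "incseq (\<lambda>n. P n u)" using P_mono[OF _ u] by (auto simp: incseq_def)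
    then obtain l where "(\<lambda>n. P n u) \<longlonglongrightarrow> l"
      using incseq_convergent P_upper[OF u] by blast
    then show ?thesis unfolding p_def by (metis limI)
  qed
  have P_le: "P n u \<le> p u" if u: "u \<in> {a..m}" for n u
    by (rule incseq_le[OF _ P_lim[OF u]]) (use P_mono[OF _ u] in \<open>auto simp: incseq_def\<close>)
  have p_upper: "p u \<le> ?M * (u - a)" if u: "u \<in> {a..m}" for u
    by (rule LIMSEQ_le_const2[OF P_lim[OF u]]) (use P_upper[OF u] in auto)
  have p_slope: "p s - C * (u - s) \<le> p u" if "a \<le> s" "s \<le> u" "u \<le> m" for s u
    by (rule LIMSEQ_le[OF tendsto_diff[OF P_lim tendsto_const] P_lim]) (use that P_slope[OF that] in auto)
  have pa: "p a = 0" using P_lim[of a] am by (simp add: Pa LIMSEQ_const_iff)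
  \<comment> \<open>From the crude bound \<open>- C * (r - a)\<close> at the midpoint \<open>r\<close> of \<open>(a, s)\<close>, a solution has to
    reach height \<open>\<theta>\<close> by \<open>s\<close>; slope \<open>k\<close> suffices for this, and \<open>\<theta>\<close> is chosen so small that
    the drift below height \<open>\<theta>\<close> is at least \<open>k\<close>. Being positive, the drift also keeps the
    solution above \<open>\<theta>\<close> up to \<open>t\<close>.\<close>
  have P_lower: "\<exists>\<theta>>0. \<exists>N. \<forall>n\<ge>N. \<forall>u\<in>{s..t}. \<theta> \<le> P n u" if st: "a < s" "s \<le> t" "t < m" for s t
  proof -
    define r where "r = (a + s) / 2"
    have r: "a < r" "r < s" using st by (auto simp: r_def)
    have sub: "{r..t} \<subseteq> {a..m}" "{s..t} \<subseteq> {a..m}" using r st by auto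
    obtain v where v: "v \<in> {r..t}" "\<And>u. u \<in> {r..t} \<Longrightarrow> G v \<le> G u"
      using continuous_attains_inf[OF _ _ continuous_on_subset[OF G sub(1)]] r st by auto
    define g where "g = G v"
    have g: "0 < g" using Gpos[of v] v r st by (auto simp: g_def)
    define k where "k = (1 + C * (r - a)) / (s - r)"
    have k: "0 < k" using C r by (auto simp: k_def intro!: divide_pos_pos add_pos_nonneg)
    define \<theta> where "\<theta> = min 1 (g / (C + k))"
    have \<theta>: "0 < \<theta>" "\<theta> \<le> 1" "\<theta> \<le> g / (C + k)" using g C k by (auto simp: \<theta>_def)
    have "\<theta> * (C + k) \<le> g" using \<theta>(3) C k by (simp add: le_divide_eq)
    then have gk: "C + k \<le> g / \<theta>" using \<theta>(1) by (simp add: le_divide_eq mult.commute)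
    obtain N where N: "\<And>n. n \<ge> N \<Longrightarrow> e n < \<theta>"
      using order_tendstoD(2)[OF e_lim \<theta>(1)] by (auto simp: eventually_sequentially)
    have "\<theta> \<le> P n u" if n: "n \<ge> N" and u: "u \<in> {s..t}" for n u
    proof -
      have steep: "k \<le> F x + G x / max (P n x) (e n)" if x: "x \<in> {r..t}" and low: "P n x < \<theta>" for x
      proof -
        have "g / \<theta> \<le> G x / max (P n x) (e n)"
          using v(2)[OF x] g mx[of n x] low N[OF n] by (intro frac_le) (auto simp: g_def)
        then show ?thesis using gk Fb(2)[of x] x sub by auto
      qed
      have "0 \<le> P n s - (\<theta> - k * (s - s))"
      proof (rule nonneg_of_barrier[where s=r and t=s and x=s and \<phi>="\<lambda>x. P n x - (\<theta> - k * (s - x))"])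
        show "continuous_on {r..s} (\<lambda>x. P n x - (\<theta> - k * (s - x)))"
          using r st by (intro continuous_intros continuous_on_subset[OF Pc]) auto
        have "k * (s - r) = 1 + C * (r - a)" using r by (simp add: k_def)
        moreover have "- (C * (r - a)) \<le> P n r" using P_slope[of a r n] r st by (simp add: Pa)
        ultimately show "0 \<le> P n r - (\<theta> - k * (s - r))" using \<theta>(2) by linarith
        fix x assume x: "r < x" "x < s" and neg: "P n x - (\<theta> - k * (s - x)) < 0"
        have "0 \<le> k * (s - x)" using x k by simp
        then have "k \<le> F x + G x / max (P n x) (e n)" by (intro steep) (use x st neg in auto)
        then have "0 \<le> F x + G x / max (P n x) (e n) - (0 - k * (0 - 1))" by simp
        moreover have "((\<lambda>x. P n x - (\<theta> - k * (s - x))) has_real_derivative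
            F x + G x / max (P n x) (e n) - (0 - k * (0 - 1))) (at x)"
          by (intro DERIV_diff DERIV_cmult DERIV_ident DERIV_const Pd) (use x r st in auto)
        ultimately show "\<exists>D\<ge>0. ((\<lambda>x. P n x - (\<theta> - k * (s - x))) has_real_derivative D) (at x)" by blast
      qed (use r in auto)
      then have start: "0 \<le> P n s - \<theta>" by simp
      have "0 \<le> P n u - \<theta>"
      proof (rule nonneg_of_barrier[where s=s and t=t and x=u and \<phi>="\<lambda>x. P n x - \<theta>"])
        show "continuous_on {s..t} (\<lambda>x. P n x - \<theta>)"
          using st by (intro continuous_intros continuous_on_subset[OF Pc]) auto
        fix x assume x: "s < x" "x < t" and neg: "P n x - \<theta> < 0"
        have "k \<le> F x + G x / max (P n x) (e n)" by (intro steep) (use x r neg in auto)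
        with k have "0 \<le> F x + G x / max (P n x) (e n) - 0" by simp
        moreover have "((\<lambda>x. P n x - \<theta>) has_real_derivative F x + G x / max (P n x) (e n) - 0) (at x)"
          by (intro DERIV_diff DERIV_const Pd) (use x st in auto)
        ultimately show "\<exists>D\<ge>0. ((\<lambda>x. P n x - \<theta>) has_real_derivative D) (at x)" by blast
      qed (use start u in auto)
      then show ?thesis by simp
    qed
    with \<theta>(1) show ?thesis by blast
  qed
  have p_deriv: "0 < p u \<and> (p has_real_derivative F u + G u / p u) (at u)" if u: "a < u" "u < m" for u
  proof -
    define s where "s = (a + u) / 2"
    define t where "t = (u + m) / 2"
    have st: "a < s" "s < u" "u < t" "t < m" using u by (auto simp: s_def t_def)
    have sub: "{s..t} \<subseteq> {a..m}" using st by auto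
    obtain \<theta> N where \<theta>: "0 < \<theta>" and N: "\<And>n x. n \<ge> N \<Longrightarrow> x \<in> {s..t} \<Longrightarrow> \<theta> \<le> P n x"
      using P_lower[of s t] st by fastforce
    have p\<theta>: "\<theta> \<le> p x" if "x \<in> {s..t}" for x
      using N[OF order_refl that] P_le[of x N] that sub by fastforce
    have "bounded (G ` {a..m})" by (intro compact_imp_bounded compact_continuous_image G) auto
    then obtain B where B: "0 < B" "\<And>x. x \<in> {a..m} \<Longrightarrow> \<bar>G x\<bar> \<le> B"
      unfolding bounded_pos by auto
    have hasint: "((\<lambda>x. F x + G x / p x) has_integral p x - p s) {s..x}" if x: "x \<in> {s..t}" for x
    proof (rule has_integral_dominated_convergence[where f="\<lambda>n x. F x + G x / max (P (n + N) x) (e (n + N))"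
          and h="\<lambda>_. C + B / \<theta>"])
      have sx: "{s..x} \<subseteq> {s..t}" using x by auto
      fix n
      show "((\<lambda>x. F x + G x / max (P (n + N) x) (e (n + N))) has_integral P (n + N) x - P (n + N) s) {s..x}"
        by (rule fundamental_theorem_of_calculus_interior)
          (use x st in \<open>auto intro!: Pd continuous_on_subset[OF Pc]
            simp: has_real_derivative_iff_has_vector_derivative[symmetric]\<close>)
      show "\<forall>y\<in>{s..x}. norm (F y + G y / max (P (n + N) y) (e (n + N))) \<le> C + B / \<theta>"
      proof
        fix y assume y: "y \<in> {s..x}"
        then have y': "y \<in> {s..t}" "y \<in> {a..m}" using sx sub by auto
        have "\<bar>G y / max (P (n + N) y) (e (n + N))\<bar> \<le> B / \<theta>"
          unfolding abs_divide using B(2)[OF y'(2)] N[of "n + N" y] y'(1) \<theta> B(1)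
          by (intro frac_le) (auto simp: abs_if le_max_iff_disj max_def)
        with C(2)[OF y'(2)] show "norm (F y + G y / max (P (n + N) y) (e (n + N))) \<le> C + B / \<theta>"
          unfolding real_norm_def by linarith
      qed
    next
      show "\<forall>y\<in>{s..x}. (\<lambda>n. F y + G y / max (P (n + N) y) (e (n + N))) \<longlonglongrightarrow> F y + G y / p y"
      proof
        fix y assume y: "y \<in> {s..x}"
        then have y': "y \<in> {s..t}" "y \<in> {a..m}" using x sub by auto
        have "(\<lambda>n. max (P (n + N) y) (e (n + N))) \<longlonglongrightarrow> max (p y) 0"
          by (intro tendsto_max LIMSEQ_ignore_initial_segment P_lim y' e_lim)
        moreover have "max (p y) 0 = p y" "p y \<noteq> 0" using p\<theta>[OF y'(1)] \<theta> by auto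
        ultimately show "(\<lambda>n. F y + G y / max (P (n + N) y) (e (n + N))) \<longlonglongrightarrow> F y + G y / p y"
          by (intro tendsto_add tendsto_const tendsto_divide) simp_all
      qed
      show "(\<lambda>n. P (n + N) x - P (n + N) s) \<longlonglongrightarrow> p x - p s"
        by (intro tendsto_diff LIMSEQ_ignore_initial_segment P_lim) (use x st in auto)
    qed (rule integrable_const_ivl)
    let ?I = "\<lambda>x. p s + integral {s..x} (\<lambda>x. F x + G x / p x)"
    have eq: "p x = ?I x" if "x \<in> {s..t}" for x using integral_unique[OF hasint[OF that]] by simp
    have "(\<lambda>x. F x + G x / p x) integrable_on {s..t}"
      using hasint[of t] st by auto
    then have "continuous_on {s..t} ?I"
      by (intro continuous_on_add continuous_on_const indefinite_integral_continuous_1)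
    then have pc: "continuous_on {s..t} p" by (rule continuous_on_eq) (rule eq[symmetric])
    have "p x \<noteq> 0" if "x \<in> {s..t}" for x using p\<theta>[OF that] \<theta> by simp
    then have "continuous_on {s..t} (\<lambda>x. F x + G x / p x)"
      by (intro continuous_on_add continuous_on_divide pc continuous_on_subset[OF F sub]
          continuous_on_subset[OF G sub]) blast
    then have "(?I has_real_derivative 0 + (F u + G u / p u)) (at u within {s..t})"
      by (intro DERIV_add DERIV_const integral_has_real_derivative) (use st in auto)
    then have "(p has_real_derivative F u + G u / p u) (at u within {s..t})"
      unfolding add_0_left
      by (rule has_field_derivative_transform_within[OF _ zero_less_one _ eq[symmetric]]) (use st in auto)
    then show ?thesis using p\<theta>[of u] \<theta> st by (simp add: at_within_Icc_at)
  qed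
  have "continuous (at u within {a..m}) p" if u: "u \<in> {a..m}" for u
  proof -
    consider "u = a" | "a < u \<and> u < m" | "u = m" using u by fastforce
    then show ?thesis
    proof cases
      case 1
      have "((\<lambda>x. - (C * (x - a))) \<longlongrightarrow> - (C * (a - a))) (at a within {a..m})"
        "((\<lambda>x. ?M * (x - a)) \<longlongrightarrow> ?M * (a - a)) (at a within {a..m})"
        by (intro tendsto_intros)+
      then have "(p \<longlongrightarrow> 0) (at a within {a..m})"
        by (intro tendsto_sandwich[where f="\<lambda>x. - (C * (x - a))" and h="\<lambda>x. ?M * (x - a)" and g=p])
          (use p_upper p_slope[of a] pa in \<open>auto simp: eventually_at_filter\<close>)
      then show ?thesis using 1 pa by (simp add: continuous_within)
    next
      case 2
      then show ?thesis using p_deriv[of u] DERIV_isCont continuous_at_imp_continuous_at_within by blast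
    next
      case 3
      \<comment> \<open>As a supremum of continuous functions \<open>p\<close> is lower semicontinuous; the upper estimate
        holds because \<open>p u + C * u\<close> is nondecreasing. No lower bound on \<open>p\<close> is available at \<open>m\<close>,
        where \<open>G\<close> may vanish.\<close>
      have "(p \<longlongrightarrow> p m) (at m within {a..m})"
      proof (rule order_tendstoI)
        fix y assume "y < p m"
        then obtain n where "y < P n m"
          using order_tendstoD(1)[OF P_lim[of m]] am by (auto simp: eventually_sequentially)
        moreover have "(P n \<longlongrightarrow> P n m) (at m within {a..m})"
          using Pc[of n] am by (auto simp: continuous_on)
        ultimately have "\<forall>\<^sub>F x in at m within {a..m}. y < P n x" by (rule order_tendstoD(1)[rotated])
        then show "\<forall>\<^sub>F x in at m within {a..m}. y < p x"
          unfolding eventually_at_filter by eventually_elim (use P_le less_le_trans in blast)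
      next
        fix y assume y: "p m < y"
        have "((\<lambda>x. p m + C * (m - x)) \<longlongrightarrow> p m + C * (m - m)) (at m within {a..m})"
          by (intro tendsto_intros)
        then have "\<forall>\<^sub>F x in at m within {a..m}. p m + C * (m - x) < y"
          by (rule order_tendstoD(2)) (use y in simp)
        then show "\<forall>\<^sub>F x in at m within {a..m}. p x < y"
          unfolding eventually_at_filter by eventually_elim (use p_slope[of _ m] in fastforce)
      qed
      then show ?thesis using 3 by (simp add: continuous_within)
    qed
  qed
  then have "branch F G a m p"
    unfolding branch_def continuous_on_eq_continuous_within using pa p_deriv by blast
  then show ?thesis by (rule that)
qed

section \<open>Matching the two halves of a connecting curve\<close>

text \<open>
  The difference quotient of \<open>G\<close> at its zero \<open>a\<close>, completed by the derivative, is continuous on a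
  compact interval and hence bounded.
\<close>
lemma linear_bound_at_zero:
  fixes G :: "real \<Rightarrow> real"
  assumes am: "a \<le> m" and G: "continuous_on {a..m} G" and Ga: "G a = 0"
    and dG: "(G has_real_derivative D) (at a)"
  obtains L where "0 \<le> L" "\<And>u. u \<in> {a..m} \<Longrightarrow> G u \<le> L * (u - a)"
proof -
  define q where "q u = (if u = a then D else G u / (u - a))" for u
  have "continuous (at u within {a..m}) q" if u: "u \<in> {a..m}" for u
  proof (cases "u = a")
    case True
    have "((\<lambda>x. (G x - G a) / (x - a)) \<longlongrightarrow> D) (at a)"
      using dG by (simp add: has_field_derivative_iff)
    then have "(q \<longlongrightarrow> D) (at a)"
      by (rule Lim_transform_eventually) (auto simp: q_def Ga eventually_at_filter)
    then have "isCont q a" by (simp add: isCont_def q_def)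
    with True show ?thesis by (simp add: continuous_at_imp_continuous_at_within)
  next
    case False
    have "continuous (at u within {a..m}) (\<lambda>x. G x / (x - a))"
      using False G u by (intro continuous_intros) (auto simp: continuous_on_eq_continuous_within)
    moreover have "\<forall>\<^sub>F x in at u within {a..m}. G x / (x - a) = q x"
      using eventually_neq_at_within[of a] by eventually_elim (simp add: q_def)
    ultimately show ?thesis
      using False by (auto simp: continuous_within q_def intro: Lim_transform_eventually)
  qed
  then have "continuous_on {a..m} q" by (simp add: continuous_on_eq_continuous_within)
  then have "bounded (q ` {a..m})" by (intro compact_imp_bounded compact_continuous_image) auto
  then obtain L where L: "0 < L" "\<And>u. u \<in> {a..m} \<Longrightarrow> \<bar>q u\<bar> \<le> L" unfolding bounded_pos by auto
  show ?thesis
  proof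
    show "0 \<le> L" using L by simp
    show "G u \<le> L * (u - a)" if u: "u \<in> {a..m}" for u
    proof (cases "u = a")
      case False
      with u have "0 < u - a" by simp
      with L(2)[OF u] False show ?thesis by (simp add: q_def abs_le_iff divide_le_eq)
    qed (simp add: Ga)
  qed
qed

lemma branch_end_nonneg:
  assumes p: "branch F G a m p" and am: "a < m"
  shows "0 \<le> p m"
proof (rule tendsto_lowerbound)
  show "(p \<longlongrightarrow> p m) (at_left m)"
    using branchD(1)[OF p] am by (simp add: continuous_on_Icc_at_leftD)
  show "\<forall>\<^sub>F u in at_left m. 0 \<le> p u"
    using eventually_at_left_real[OF am] by eventually_elim (use branchD(3)[OF p] in \<open>auto intro: less_imp_le\<close>)
qed simp

text \<open>
  If \<open>p m = 0\<close>, then close to \<open>m\<close> the branch is so low that \<open>G / p\<close>, with \<open>G\<close> of order \<open>m - u\<close>,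
  outweighs \<open>F\<close>, which is negative at most to order \<open>m - u\<close>. So \<open>p\<close> would be increasing and could
  not come down to zero. The strict sign of \<open>G'\<close> is essential: \<open>p u = (m - u)\<^sup>2\<close> solves
  \<open>p' = F + G / p\<close> with \<open>F u = - 3 * (m - u)\<close>, \<open>G u = (m - u) ^ 3\<close>.
\<close>
lemma branch_end_pos:
  assumes p: "branch F G a m p" and am: "a < m"
    and F: "0 \<le> F m" "(F has_real_derivative F') (at m)"
    and G: "G m = 0" "(G has_real_derivative G') (at m)" "G' < 0"
  shows "0 < p m"
proof (rule ccontr)
  assume "\<not> 0 < p m"
  with branch_end_nonneg[OF p am] have pm: "p m = 0" by simp
  define l where "l = \<bar>F'\<bar> + 1"
  define g where "g = - G' / 2"
  have l: "0 < l" "F' < l" and g: "0 < g" "G' < - g" using G by (auto simp: l_def g_def)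
  have "((\<lambda>u. (F u - F m) / (u - m)) \<longlongrightarrow> F') (at_left m)"
    using F(2) by (simp add: has_field_derivative_iff filterlim_at_split)
  then have F_ev: "\<forall>\<^sub>F u in at_left m. (F u - F m) / (u - m) < l" by (rule order_tendstoD) (rule l)
  have "((\<lambda>u. (G u - G m) / (u - m)) \<longlongrightarrow> G') (at_left m)"
    using G(2) by (simp add: has_field_derivative_iff filterlim_at_split)
  then have G_ev: "\<forall>\<^sub>F u in at_left m. (G u - G m) / (u - m) < - g" by (rule order_tendstoD) (rule g)
  have "(p \<longlongrightarrow> p m) (at_left m)"
    using branchD(1)[OF p] am by (simp add: continuous_on_Icc_at_leftD)
  then have p_ev: "\<forall>\<^sub>F u in at_left m. p u < g / l" by (rule order_tendstoD) (use l g pm in simp)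
  have "\<forall>\<^sub>F u in at_left m. 0 < F u + G u / p u"
    using F_ev G_ev p_ev eventually_at_left_real[OF am]
  proof eventually_elim
    case (elim u)
    then have u: "a < u" "u < m" by auto
    have pu: "0 < p u" by (rule branchD(3)[OF p u])
    have "F u > - l * (m - u)" using elim(1) u F(1) by (simp add: divide_less_eq algebra_simps)
    moreover have "g * (m - u) < G u" using elim(2) u G(1) by (simp add: divide_less_eq algebra_simps)
    moreover have "l * p u \<le> g" using elim(3) l by (simp add: less_divide_eq mult.commute)
    then have "l * p u * (m - u) \<le> g * (m - u)" using u by (intro mult_right_mono) auto
    ultimately have "l * (m - u) * p u < G u" by (simp add: algebra_simps)
    then have "l * (m - u) < G u / p u" using pu by (simp add: less_divide_eq)
    with \<open>F u > - l * (m - u)\<close> show ?case by simp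
  qed
  with eventually_at_left_real[OF am]
  have "\<forall>\<^sub>F u in at_left m. a < u \<and> u < m \<and> 0 < F u + G u / p u" by eventually_elim auto
  then obtain s where s: "s < m" "\<And>u. s < u \<Longrightarrow> u < m \<Longrightarrow> a < u \<and> 0 < F u + G u / p u"
    unfolding eventually_at_left_field by blast
  define t where "t = (s + m) / 2"
  have t: "s < t" "t < m" using s(1) by (auto simp: t_def)
  have at: "a < t" using s(2) t by blast
  have "p t \<le> p m"
  proof (rule DERIV_nonneg_imp_increasing_open[where f=p])
    show "continuous_on {t..m} p" using at by (intro continuous_on_subset[OF branchD(1)[OF p]]) auto
    fix u assume u: "t < u" "u < m"
    then show "\<exists>y. (p has_real_derivative y) (at u) \<and> 0 \<le> y"
      using branchD(4)[OF p, of u] s(2)[of u] t at by (intro exI[of _ "F u + G u / p u"]) auto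
  qed (use t in simp)
  with branchD(3)[OF p at t(2)] pm show False by simp
qed

text \<open>
  The shooting function: \<open>\<alpha> \<mu>\<close> is the height at which the branch with coefficient \<open>A + \<mu> * B\<close>
  arrives at \<open>m\<close>. It is Lipschitz by the gap estimate, and it is unbounded because a large \<open>\<mu>\<close> makes
  the drift exceed any given slope on the whole interval.
\<close>
lemma branch_endpoint_family:
  assumes am: "a < m" and A: "continuous_on {a..m} A" and B: "continuous_on {a..m} B"
    and G: "continuous_on {a..m} G"
    and Bpos: "\<And>u. u \<in> {a..m} \<Longrightarrow> 0 < B u"
    and Gpos: "\<And>u. a < u \<Longrightarrow> u < m \<Longrightarrow> 0 < G u"
    and L: "0 \<le> L" "\<And>u. a < u \<Longrightarrow> u < m \<Longrightarrow> G u \<le> L * (u - a)"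
  obtains \<alpha> :: "real \<Rightarrow> real" where
    "\<And>\<mu>. \<exists>p. branch (\<lambda>u. A u + \<mu> * B u) G a m p \<and> p m = \<alpha> \<mu>"
    "mono \<alpha>" "continuous_on UNIV \<alpha>" "\<And>y. \<exists>\<mu>\<ge>0. y \<le> \<alpha> \<mu>"
proof -
  have "\<exists>p. branch (\<lambda>u. A u + \<mu> * B u) G a m p" for \<mu>
    using branch_exists[OF am _ G Gpos L, of "\<lambda>u. A u + \<mu> * B u"] continuous_on_add[OF A
      continuous_on_mult[OF continuous_on_const B]] by metis
  then obtain P where P: "\<And>\<mu>. branch (\<lambda>u. A u + \<mu> * B u) G a m (P \<mu>)" by metis
  define \<alpha> where "\<alpha> \<mu> = P \<mu> m" for \<mu>
  have Gnn: "0 \<le> G u" if "a < u" "u < m" for u using Gpos[OF that] by simp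
  obtain v where v: "v \<in> {a..m}" "\<And>u. u \<in> {a..m} \<Longrightarrow> B v \<le> B u"
    using continuous_attains_inf[OF compact_Icc _ B] am by auto
  define b where "b = B v"
  have b: "0 < b" "\<And>u. u \<in> {a..m} \<Longrightarrow> b \<le> B u" using v Bpos by (auto simp: b_def)
  have "bounded (A ` {a..m})" "bounded (B ` {a..m})"
    by (intro compact_imp_bounded compact_continuous_image A B compact_Icc)+
  then obtain CA CB where "\<forall>x\<in>A ` {a..m}. norm x \<le> CA" and CB: "0 < CB"
    and "\<forall>x\<in>B ` {a..m}. norm x \<le> CB"
    unfolding bounded_pos by blast
  then have CA: "\<bar>A u\<bar> \<le> CA" and CBu: "\<bar>B u\<bar> \<le> CB" if "u \<in> {a..m}" for u
    using that by auto
  have le: "A u + \<mu> * B u \<le> A u + \<nu> * B u" if "\<mu> \<le> \<nu>" "a < u" "u < m" for \<mu> \<nu> u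
    using that Bpos[of u] by (simp add: mult_right_mono)
  have mono: "\<alpha> \<mu> \<le> \<alpha> \<nu>" if "\<mu> \<le> \<nu>" for \<mu> \<nu>
    unfolding \<alpha>_def by (rule branch_mono[OF P P Gnn le[OF that]]) (use am in auto)
  have gap: "\<alpha> \<nu> - \<alpha> \<mu> \<le> CB * (m - a) * (\<nu> - \<mu>)" if mn: "\<mu> \<le> \<nu>" for \<mu> \<nu>
  proof -
    have "\<alpha> \<nu> - \<alpha> \<mu> \<le> ((\<nu> - \<mu>) * CB) * (m - a)"
      unfolding \<alpha>_def
    proof (rule branch_gap[OF P P Gnn le[OF mn]])
      fix u assume "a < u" "u < m"
      then have "B u \<le> CB" using CBu[of u] by auto
      then have "(\<nu> - \<mu>) * B u \<le> (\<nu> - \<mu>) * CB" using mn by (intro mult_left_mono) auto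
      then show "A u + \<nu> * B u - (A u + \<mu> * B u) \<le> (\<nu> - \<mu>) * CB" by (simp add: algebra_simps)
    qed (use am in auto)
    then show ?thesis by (simp add: algebra_simps)
  qed
  have "(CB * (m - a))-lipschitz_on UNIV \<alpha>"
  proof (rule lipschitz_onI)
    show "dist (\<alpha> \<mu>) (\<alpha> \<nu>) \<le> CB * (m - a) * dist \<mu> \<nu>" for \<mu> \<nu>
      using mono[of \<mu> \<nu>] gap[of \<mu> \<nu>] mono[of \<nu> \<mu>] gap[of \<nu> \<mu>]
      by (cases "\<mu> \<le> \<nu>") (auto simp: dist_real_def abs_if)
  qed (use CB am in simp)
  then have cont: "continuous_on UNIV \<alpha>" by (rule lipschitz_on_continuous_on)
  have large: "\<exists>\<mu>\<ge>0. y \<le> \<alpha> \<mu>" for y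
  proof -
    define \<mu> where "\<mu> = (\<bar>y\<bar> / (m - a) + \<bar>CA\<bar>) / b"
    have mu: "0 \<le> \<mu>" using b am by (simp add: \<mu>_def)
    have mub: "\<mu> * b = \<bar>y\<bar> / (m - a) + \<bar>CA\<bar>" using b by (simp add: \<mu>_def)
    have "(\<bar>y\<bar> / (m - a)) * (m - a) \<le> P \<mu> m"
    proof (rule branch_ge_linear[OF P Gnn])
      fix u assume u: "a < u" "u < m"
      have "\<mu> * b \<le> \<mu> * B u" using b(2)[of u] u mu by (intro mult_left_mono) auto
      with mub CA[of u] u show "\<bar>y\<bar> / (m - a) \<le> A u + \<mu> * B u" by auto
    qed (use am in auto)
    with am mu show ?thesis by (intro exI[of _ \<mu>]) (auto simp: \<alpha>_def)
  qed
  show ?thesis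
    by (rule that[of \<alpha>]) (use P mono cont large in \<open>auto simp: \<alpha>_def mono_def\<close>)
qed

text \<open>
  Under \<open>u \<mapsto> - u\<close> a phase curve that enters the right equilibrium \<open>(b, 0)\<close> becomes one that leaves the
  left one. The signs of \<open>F\<close> and \<open>G\<close> change, so that \<open>G < 0\<close> on \<open>(m, b)\<close> turns into the positivity
  required on the left half.
\<close>
lemma branch_reflect:
  assumes cont: "continuous_on {m..b} p" and pb: "p b = 0"
    and p: "\<And>u. m < u \<Longrightarrow> u < b \<Longrightarrow> 0 < p u \<and> (p has_real_derivative F u + G u / p u) (at u)"
  shows "branch (\<lambda>s. - F (- s)) (\<lambda>s. - G (- s)) (- b) (- m) (\<lambda>s. p (- s))"
  unfolding branch_def
proof (intro conjI allI impI)
  show "continuous_on {- b..- m} (\<lambda>s. p (- s))"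
    by (rule continuous_on_compose2[OF cont]) (auto intro!: continuous_intros)
  fix s assume s: "- b < s" "s < - m"
  then have u: "m < - s" "- s < b" by auto
  show "0 < p (- s)" using p[OF u] by simp
  have "((\<lambda>s. p (- s)) has_real_derivative (F (- s) + G (- s) / p (- s)) * (- 1)) (at s)"
    by (rule DERIV_chain2[where g=uminus]) (use p[OF u] in \<open>auto intro!: derivative_eq_intros\<close>)
  then show "((\<lambda>s. p (- s)) has_real_derivative - F (- s) + - G (- s) / p (- s)) (at s)" by simp
qed (use pb in simp)

definition connection :: "(real \<Rightarrow> real) \<Rightarrow> (real \<Rightarrow> real) \<Rightarrow> real \<Rightarrow> real \<Rightarrow> (real \<Rightarrow> real) \<Rightarrow> bool" where
  "connection F G a b p \<longleftrightarrow> branch F G a b p \<and> p b = 0"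

lemma connection_left_half:
  assumes "connection F G a b p" "m < b"
  shows "branch F G a m p"
  using assms unfolding connection_def branch_def
  by (auto intro: continuous_on_subset)

lemma connection_right_half:
  assumes p: "connection F G a b p" and am: "a < m"
  shows "branch (\<lambda>s. - F (- s)) (\<lambda>s. - G (- s)) (- b) (- m) (\<lambda>s. p (- s))"
proof (rule branch_reflect)
  show "continuous_on {m..b} p"
    using p am unfolding connection_def branch_def by (auto intro: continuous_on_subset)
qed (use p am in \<open>auto simp: connection_def branch_def\<close>)

text \<open>
  The common height at \<open>m\<close> is positive, so \<open>F + G / p\<close> is continuous there; integrating
  it across \<open>m\<close> shows that the joined function is differentiable at \<open>m\<close> as well.
\<close>
lemma connection_glue:
  assumes amb: "a < m" "m < b"
    and F: "continuous_on {a..b} F" and G: "continuous_on {a..b} G"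
    and q: "branch F G a m q"
    and r: "branch (\<lambda>s. - F (- s)) (\<lambda>s. - G (- s)) (- b) (- m) r"
    and eq: "q m = r (- m)" and pos: "0 < q m"
  shows "connection F G a b (\<lambda>u. if u \<le> m then q u else r (- u))" 
proof -
  define p where "p = (\<lambda>u. if u \<le> m then q u else r (- u))"
  have cr: "continuous_on {m..b} (\<lambda>u. r (- u))"
    by (rule continuous_on_compose2[OF branchD(1)[OF r]]) (auto intro!: continuous_intros)
  have "continuous_on ({a..m} \<union> {m..b}) p"
    unfolding p_def by (rule continuous_on_cases) (use eq branchD(1)[OF q] cr in auto)
  moreover have "{a..m} \<union> {m..b} = {a..b}" using amb by auto
  ultimately have cont: "continuous_on {a..b} p" by simp
  have pos_p: "0 < p u" if u: "a < u" "u < b" for u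
    using branchD(3)[OF q, of u] branchD(3)[OF r, of "- u"] u pos
    by (cases "u = m") (auto simp: p_def)
  have d: "(p has_real_derivative F u + G u / p u) (at u)" if u: "a < u" "u < b" "u \<noteq> m" for u
  proof (cases "u < m")
    case True
    have "(q has_real_derivative F u + G u / q u) (at u)" using branchD(4)[OF q] u True by simp
    then have "(p has_real_derivative F u + G u / q u) (at u)"
      by (rule has_field_derivative_transform_within_open[OF _ open_lessThan[of m]]) (use True in \<open>auto simp: p_def\<close>)
    with True show ?thesis by (simp add: p_def)
  next
    case False
    with u have u': "- b < - u" "- u < - m" by auto
    have "((\<lambda>x. r (- x)) has_real_derivative (- F (- (- u)) + - G (- (- u)) / r (- u)) * (- 1)) (at u)"
      by (rule DERIV_chain2[where g=uminus, OF branchD(4)[OF r u']]) (auto intro!: derivative_eq_intros)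
    then have "((\<lambda>x. r (- x)) has_real_derivative F u + G u / r (- u)) (at u)" by (simp add: add.commute)
    then have "(p has_real_derivative F u + G u / r (- u)) (at u)"
      by (rule has_field_derivative_transform_within_open[OF _ open_greaterThan[of m]]) (use False u in \<open>auto simp: p_def\<close>)
    with False u show ?thesis by (simp add: p_def)
  qed
  have dm: "(p has_real_derivative F m + G m / p m) (at m)"
  proof -
    define s where "s = (a + m) / 2"
    define t where "t = (m + b) / 2"
    have st: "a < s" "s < m" "m < t" "t < b" using amb by (auto simp: s_def t_def)
    have sub: "{s..t} \<subseteq> {a..b}" using st by auto
    have hasint: "((\<lambda>x. F x + G x / p x) has_integral p x - p s) {s..x}" if x: "x \<in> {s..t}" for x
      by (rule fundamental_theorem_of_calculus_interior_strong[where S="{m}"])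
        (use x st d in \<open>auto intro!: continuous_on_subset[OF cont]
            simp: has_real_derivative_iff_has_vector_derivative[symmetric]\<close>)
    have "p x \<noteq> 0" if "x \<in> {s..t}" for x
      using pos_p[of x] that st by simp
    then have "continuous_on {s..t} (\<lambda>x. F x + G x / p x)"
      by (intro continuous_on_add continuous_on_divide continuous_on_subset[OF F sub]
          continuous_on_subset[OF G sub] continuous_on_subset[OF cont sub]) blast
    then have "((\<lambda>x. p s + integral {s..x} (\<lambda>x. F x + G x / p x)) has_real_derivative
        0 + (F m + G m / p m)) (at m within {s..t})"
      by (intro DERIV_add DERIV_const integral_has_real_derivative) (use st in auto)
    then have "(p has_real_derivative F m + G m / p m) (at m within {s..t})"
      unfolding add_0_left
      by (rule has_field_derivative_transform_within[OF _ zero_less_one])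
        (use st integral_unique[OF hasint] in auto)
    then show ?thesis using st by (simp only: at_within_Icc_at)
  qed
  have "p a = 0" using branchD(2)[OF q] amb by (simp add: p_def)
  moreover have "p b = 0" using branchD(2)[OF r] amb by (simp add: p_def)
  moreover have "(p has_real_derivative F u + G u / p u) (at u)" if "a < u" "u < b" for u
    using d[OF that] dm by (cases "u = m") auto
  ultimately show ?thesis
    unfolding connection_def branch_def p_def[symmetric] using cont pos_p by blast
qed

text \<open>
  Existence: raising \<open>\<mu>\<close> raises the height \<open>\<alpha> \<mu>\<close> at which the left branch arrives at \<open>m\<close> and lowers the height
  \<open>\<beta> (- \<mu>)\<close> of the reflected right one, so the two agree for some \<open>\<mu>\<close>. Uniqueness: for \<open>\<mu>1 < \<mu>2\<close>
  the second curve is above the first one on \<open>[a, m]\<close> and below it on \<open>[m, b]\<close>, although at \<open>m\<close>, where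
  \<open>G\<close> vanishes, it is the steeper one by \<open>(\<mu>2 - \<mu>1) * B m\<close>.
\<close>
theorem unique_connection_parameter:
  fixes A B G :: "real \<Rightarrow> real"
  assumes amb: "a < m" "m < b"
    and A: "continuous_on {a..b} A" and B: "continuous_on {a..b} B" and G: "continuous_on {a..b} G"
    and Bpos: "\<And>u. u \<in> {a..b} \<Longrightarrow> 0 < B u"
    and Gzero: "G a = 0" "G m = 0" "G b = 0"
    and Gpos: "\<And>u. a < u \<Longrightarrow> u < m \<Longrightarrow> 0 < G u"
    and Gneg: "\<And>u. m < u \<Longrightarrow> u < b \<Longrightarrow> G u < 0"
    and dA: "(A has_real_derivative A') (at m)" and dB: "(B has_real_derivative B') (at m)"
    and dG: "(G has_real_derivative Ga) (at a)" "(G has_real_derivative Gm) (at m)" "Gm < 0"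
      "(G has_real_derivative Gb) (at b)"
  shows "\<exists>\<mu>0. \<forall>\<mu>. (\<exists>p. connection (\<lambda>u. A u + \<mu> * B u) G a b p) \<longleftrightarrow> \<mu> = \<mu>0"
proof -
  let ?F = "\<lambda>\<mu> u. A u + \<mu> * B u"
  let ?R = "\<lambda>(f::real\<Rightarrow>real) s. - f (- s)"
  have subl: "{a..m} \<subseteq> {a..b}" using amb by auto
  have cR: "continuous_on {- b..- m} (\<lambda>s. f (- s))" if "continuous_on {a..b} f" for f :: "real \<Rightarrow> real"
    by (rule continuous_on_compose2[OF that]) (use amb in \<open>auto intro!: continuous_intros\<close>)
  have dR: "(?R f has_real_derivative D) (at (- x))" if "(f has_real_derivative D) (at x)" for f D x
  proof -
    have "((\<lambda>s. f (- s)) has_real_derivative D * (- 1)) (at (- x))"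
      by (rule DERIV_chain2[where g=uminus]) (use that in \<open>auto intro!: derivative_eq_intros\<close>)
    from DERIV_minus[OF this] show ?thesis by simp
  qed
  obtain L where L: "0 \<le> L" "\<And>u. u \<in> {a..m} \<Longrightarrow> G u \<le> L * (u - a)"
    using linear_bound_at_zero[OF _ continuous_on_subset[OF G subl] Gzero(1) dG(1)] amb by auto
  obtain L' where L': "0 \<le> L'" "\<And>u. u \<in> {- b..- m} \<Longrightarrow> ?R G u \<le> L' * (u - - b)"
    using linear_bound_at_zero[of "- b" "- m" "?R G" Gb] amb Gzero(3) dR[OF dG(4)]
      continuous_on_minus[OF cR[OF G]] by auto
  obtain \<alpha> where \<alpha>: "\<And>\<mu>. \<exists>p. branch (?F \<mu>) G a m p \<and> p m = \<alpha> \<mu>"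
    "mono \<alpha>" "continuous_on UNIV \<alpha>" "\<And>y. \<exists>\<mu>\<ge>0. y \<le> \<alpha> \<mu>"
    by (rule branch_endpoint_family[of a m A B G L])
      (use amb L Gpos Bpos continuous_on_subset[OF A subl] continuous_on_subset[OF B subl]
        continuous_on_subset[OF G subl] in auto)
  obtain \<beta> where \<beta>: "\<And>\<mu>. \<exists>p. branch (\<lambda>s. ?R A s + \<mu> * B (- s)) (?R G) (- b) (- m) p \<and> p (- m) = \<beta> \<mu>"
    "mono \<beta>" "continuous_on UNIV \<beta>" "\<And>y. \<exists>\<mu>\<ge>0. y \<le> \<beta> \<mu>"
    by (rule branch_endpoint_family[of "- b" "- m" "?R A" "\<lambda>s. B (- s)" "?R G" L'])
      (use amb L' Gneg Bpos continuous_on_minus[OF cR[OF A]] cR[OF B] continuous_on_minus[OF cR[OF G]] in auto)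
  have RF: "?R (?F \<mu>) = (\<lambda>s. ?R A s + (- \<mu>) * B (- s))" for \<mu> by (rule ext) simp
  have "\<exists>\<mu>. \<alpha> \<mu> - \<beta> (- \<mu>) = 0"
  proof -
    obtain x where x: "0 \<le> x" "\<beta> 0 \<le> \<alpha> x" using \<alpha>(4) by blast
    obtain y where y: "0 \<le> y" "\<alpha> 0 \<le> \<beta> y" using \<beta>(4) by blast
    have "\<beta> (- x) \<le> \<beta> 0" "\<alpha> (- y) \<le> \<alpha> 0" using x y \<alpha>(2) \<beta>(2) by (auto simp: mono_def)
    moreover have "continuous_on {- y..x} (\<lambda>\<mu>. \<alpha> \<mu> - \<beta> (- \<mu>))"
      by (intro continuous_on_diff continuous_on_subset[OF \<alpha>(3)] continuous_on_compose2[OF \<beta>(3)]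
          continuous_intros) auto
    ultimately show ?thesis
      using IVT'[of "\<lambda>\<mu>. \<alpha> \<mu> - \<beta> (- \<mu>)" "- y" 0 x] x y by auto
  qed
  then obtain \<mu>0 where \<mu>0: "\<alpha> \<mu>0 = \<beta> (- \<mu>0)" by auto
  have ex: "\<exists>p. connection (?F \<mu>0) G a b p"
  proof -
    obtain q where q: "branch (?F \<mu>0) G a m q" "q m = \<alpha> \<mu>0" using \<alpha>(1) by blast
    obtain r where r: "branch (?R (?F \<mu>0)) (?R G) (- b) (- m) r" "r (- m) = \<beta> (- \<mu>0)"
      using \<beta>(1)[of "- \<mu>0"] unfolding RF by blast
    have dF: "(?F \<mu>0 has_real_derivative A' + \<mu>0 * B') (at m)"
      by (intro DERIV_add DERIV_cmult dA dB)
    \<comment> \<open>Reflection changes the sign of the coefficient at \<open>m\<close>, so one of the two halves has the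
      nonnegative coefficient that forces a positive height at \<open>m\<close>.\<close>
    have pos: "0 < q m"
    proof (cases "0 \<le> ?F \<mu>0 m")
      case True
      then show ?thesis by (rule branch_end_pos[OF q(1) amb(1) _ dF Gzero(2) dG(2,3)])
    next
      case False
      have "0 < r (- m)"
        by (rule branch_end_pos[OF r(1) _ _ dR[OF dF] _ dR[OF dG(2)] dG(3)])
          (use False amb Gzero in auto)
      then show ?thesis using q r \<mu>0 by simp
    qed
    have "continuous_on {a..b} (?F \<mu>0)" by (intro continuous_intros A B)
    from connection_glue[OF amb this G q(1) r(1) _ pos] q(2) r(2) \<mu>0 show ?thesis by auto
  qed
  have no: False if p1: "connection (?F \<mu>1) G a b p1" and p2: "connection (?F \<mu>2) G a b p2"
    and lt: "\<mu>1 < \<mu>2" for \<mu>1 \<mu>2 p1 p2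
  proof -
    have le: "?F \<mu>1 u \<le> ?F \<mu>2 u" if "u \<in> {a..b}" for u
      using lt Bpos[OF that] by (simp add: mult_right_mono)
    have left: "p1 m \<le> p2 m"
      by (rule branch_mono[OF connection_left_half[OF p1 amb(2)] connection_left_half[OF p2 amb(2)]])
        (use amb Gpos le in \<open>auto intro: less_imp_le\<close>)
    have right: "p2 u \<le> p1 u" if u: "u \<in> {m..b}" for u
    proof -
      have "p2 (- (- u)) \<le> p1 (- (- u))"
        by (rule branch_mono[OF connection_right_half[OF p2 amb(1)] connection_right_half[OF p1 amb(1)]])
          (use u amb Gneg le in \<open>auto intro: less_imp_le\<close>)
      then show ?thesis by simp
    qed
    have "((\<lambda>u. p2 u - p1 u) has_real_derivative
        (?F \<mu>2 m + G m / p2 m) - (?F \<mu>1 m + G m / p1 m)) (at m)"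
      by (intro DERIV_diff branchD(4)) (use p1 p2 amb in \<open>auto simp: connection_def\<close>)
    moreover have "0 < (?F \<mu>2 m + G m / p2 m) - (?F \<mu>1 m + G m / p1 m)"
      using Gzero(2) lt Bpos[of m] amb by (simp add: mult_strict_right_mono)
    ultimately obtain d where d: "0 < d" "\<And>h. 0 < h \<Longrightarrow> h < d \<Longrightarrow> p2 m - p1 m < p2 (m + h) - p1 (m + h)"
      using DERIV_pos_inc_right by blast
    define h where "h = min (d / 2) (b - m)"
    have "0 < h" "h < d" "m + h \<in> {m..b}" using d amb by (auto simp: h_def)
    with d(2)[of h] right[of "m + h"] left show False by simp
  qed
  show ?thesis
  proof (intro exI[of _ \<mu>0] allI iffI)
    fix \<mu> assume "\<exists>p. connection (?F \<mu>) G a b p"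
    then show "\<mu> = \<mu>0" using ex no[of \<mu> _ \<mu>0] no[of \<mu>0 _ \<mu>] by (cases \<mu> \<mu>0 rule: linorder_cases) blast+
  next
    fix \<mu> assume "\<mu> = \<mu>0"
    with ex show "\<exists>p. connection (?F \<mu>) G a b p" by simp
  qed
qed

section \<open>Connecting curves and heteroclinic orbits\<close>

text \<open>
  The derivative rule for an inverse that is not yet known to be continuous.
\<close>
lemma DERIV_inverse_strong:
  fixes f g :: "real \<Rightarrow> real"
  assumes "(f has_real_derivative D) (at x)" "D \<noteq> 0" "open S" "x \<in> S" "continuous_on S f"
    and "\<And>y. y \<in> S \<Longrightarrow> g (f y) = y"
  shows "(g has_real_derivative inverse D) (at (f x))"
  using assms unfolding has_field_derivative_def
  by (intro has_derivative_inverse_strong[of S x f g]) auto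

lemma increasing_between_limits:
  fixes u w :: "real \<Rightarrow> real"
  assumes du: "\<And>z. (u has_real_derivative w z) (at z)" and w: "\<And>z. 0 < w z"
    and bot: "(u \<longlongrightarrow> a) at_bot" and top: "(u \<longlongrightarrow> b) at_top"
  shows "strict_mono u" "a < u z" "u z < b"
proof -
  show mono: "strict_mono u"
    unfolding strict_mono_def using DERIV_pos_imp_increasing[of _ _ u] du w by blast
  have "a \<le> u (z - 1)"
    by (rule tendsto_upperbound[OF bot]) (auto simp: eventually_at_bot_linorder strict_mono_less_eq[OF mono])
  also have "\<dots> < u z" using mono by (simp add: strict_mono_def)
  finally show "a < u z" .
  have "u z < u (z + 1)" using mono by (simp add: strict_mono_def)
  also have "\<dots> \<le> b"
    by (rule tendsto_lowerbound[OF top]) (auto simp: eventually_at_top_linorder strict_mono_less_eq[OF mono])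
  finally show "u z < b" .
qed

definition heteroclinic ::
  "(real \<Rightarrow> real) \<Rightarrow> (real \<Rightarrow> real) \<Rightarrow> real \<Rightarrow> real \<Rightarrow> (real \<Rightarrow> real) \<Rightarrow> (real \<Rightarrow> real) \<Rightarrow> bool" where
  "heteroclinic F G a b u w \<longleftrightarrow>
     (\<forall>z. (u has_real_derivative w z) (at z) \<and>
          (w has_real_derivative G (u z) + F (u z) * w z) (at z) \<and> 0 < w z) \<and>
     (u \<longlongrightarrow> a) at_bot \<and> (u \<longlongrightarrow> b) at_top \<and> (w \<longlongrightarrow> 0) at_bot \<and> (w \<longlongrightarrow> 0) at_top"

text \<open>
  The curve is \<open>p = w \<circ> v\<close> with \<open>v\<close> the inverse of the strictly increasing profile \<open>u\<close>; the chain rule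
  divides the second equation by \<open>u' = w\<close>.
\<close>
lemma heteroclinic_imp_connection:
  assumes het: "heteroclinic F G a b u w" and ab: "a < b"
  shows "\<exists>p. connection F G a b p"
proof -
  have du: "\<And>z. (u has_real_derivative w z) (at z)"
    and dw: "\<And>z. (w has_real_derivative G (u z) + F (u z) * w z) (at z)"
    and w: "\<And>z. 0 < w z" and ubot: "(u \<longlongrightarrow> a) at_bot" and utop: "(u \<longlongrightarrow> b) at_top"
    and wbot: "(w \<longlongrightarrow> 0) at_bot" and wtop: "(w \<longlongrightarrow> 0) at_top"
    using het by (auto simp: heteroclinic_def)
  note incr = increasing_between_limits[OF du w ubot utop]
  define v where "v = inv u"
  have vu: "v (u z) = z" for z
    unfolding v_def by (rule inv_f_f) (rule strict_mono_imp_inj_on[OF incr(1)])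
  have cu: "continuous_on S u" for S
    using du by (meson DERIV_isCont continuous_at_imp_continuous_on)
  have onto: "\<exists>z. u z = x" if x: "a < x" "x < b" for x
  proof -
    obtain z1 where z1: "u z1 < x"
      using order_tendstoD(2)[OF ubot x(1)] by (auto simp: eventually_at_bot_linorder)
    obtain z2 where z2: "x < u z2"
      using order_tendstoD(1)[OF utop x(2)] by (auto simp: eventually_at_top_linorder)
    have "z1 \<le> z2" using z1 z2 strict_mono_less[OF incr(1), of z1 z2] by linarith
    then show ?thesis using IVT'[OF _ _ _ cu, of z1 x z2] z1 z2 by auto
  qed
  have v_bot: "filterlim v at_bot (at_right a)"
    unfolding filterlim_at_bot
  proof
    fix Z
    show "\<forall>\<^sub>F x in at_right a. v x \<le> Z"
      using eventually_at_right_real[OF incr(2)[of Z]]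
    proof eventually_elim
      case (elim x)
      with incr(3)[of Z] onto[of x] obtain z where z: "u z = x" by auto
      with elim have "z < Z" using strict_mono_less[OF incr(1), of z Z] by auto
      with z show ?case using vu[of z] by simp
    qed
  qed
  have v_top: "filterlim v at_top (at_left b)"
    unfolding filterlim_at_top
  proof
    fix Z
    show "\<forall>\<^sub>F x in at_left b. Z \<le> v x"
      using eventually_at_left_real[OF incr(3)[of Z]]
    proof eventually_elim
      case (elim x)
      with incr(2)[of Z] onto[of x] obtain z where z: "u z = x" by auto
      with elim have "Z < z" using strict_mono_less[OF incr(1), of Z z] by auto
      with z show ?case using vu[of z] by simp
    qed
  qed
  define p where "p x = (if a < x \<and> x < b then w (v x) else 0)" for x
  have p_deriv: "0 < p x \<and> (p has_real_derivative F x + G x / p x) (at x)" if x: "a < x" "x < b" for x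
  proof -
    obtain z where z: "u z = x" using onto[OF x] by blast
    have px: "p x = w z" using x z vu[of z] by (simp add: p_def)
    have "(v has_real_derivative inverse (w z)) (at (u z))"
      by (rule DERIV_inverse_strong[OF du _ open_UNIV _ cu]) (use w[of z] vu in auto)
    then have dv: "(v has_real_derivative inverse (w z)) (at x)" using z by simp
    have dw': "(w has_real_derivative G x + F x * w z) (at (v x))" using dw[of z] vu[of z] z by simp
    have "((\<lambda>x. w (v x)) has_real_derivative (G x + F x * w z) * inverse (w z)) (at x)"
      by (rule DERIV_chain2[OF dw' dv])
    moreover have "(G x + F x * w z) * inverse (w z) = F x + G x / p x"
      using w[of z] px by (simp add: field_simps)
    ultimately have "((\<lambda>x. w (v x)) has_real_derivative F x + G x / p x) (at x)" by simp
    then have "(p has_real_derivative F x + G x / p x) (at x)"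
      by (rule has_field_derivative_transform_within_open[OF _ open_greaterThanLessThan[of a b]])
        (use x in \<open>auto simp: p_def\<close>)
    with px w[of z] show ?thesis by simp
  qed
  have "continuous_on {a..b} p"
  proof (rule continuous_on_IccI[OF _ _ _ ab])
    have "((\<lambda>x. w (v x)) \<longlongrightarrow> 0) (at_right a)" by (rule filterlim_compose[OF wbot v_bot])
    moreover have "\<forall>\<^sub>F x in at_right a. w (v x) = p x"
      using eventually_at_right_real[OF ab] by eventually_elim (auto simp: p_def)
    ultimately show "(p \<longlongrightarrow> p a) (at_right a)" by (simp add: p_def[of a] Lim_transform_eventually)
    have "((\<lambda>x. w (v x)) \<longlongrightarrow> 0) (at_left b)" by (rule filterlim_compose[OF wtop v_top])
    moreover have "\<forall>\<^sub>F x in at_left b. w (v x) = p x"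
      using eventually_at_left_real[OF ab] by eventually_elim (auto simp: p_def)
    ultimately show "(p \<longlongrightarrow> p b) (at_left b)" by (simp add: p_def[of b] Lim_transform_eventually)
    show "p \<midarrow>x\<rightarrow> p x" if "a < x" "x < b" for x
      using p_deriv[OF that] DERIV_isCont isCont_def by blast
  qed
  then have "connection F G a b p"
    using p_deriv by (auto simp: connection_def branch_def p_def[of a] p_def[of b])
  then show ?thesis by blast
qed

text \<open>
  The orbit is recovered from its time \<open>T = \<integral> du / p\<close>. The linear bounds on \<open>p\<close> make \<open>T\<close> diverge at
  least logarithmically at both ends, so that \<open>T\<close> maps \<open>(a, b)\<close> onto the line and its inverse \<open>u\<close> is defined
  for all times.
\<close>
lemma connection_imp_heteroclinic:
  assumes p: "connection F G a b p" and ab: "a < b" and M: "0 < M"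
    and pa: "\<And>x. a < x \<Longrightarrow> x < b \<Longrightarrow> p x \<le> M * (x - a)"
    and pb: "\<And>x. a < x \<Longrightarrow> x < b \<Longrightarrow> p x \<le> M * (b - x)"
  shows "\<exists>u w. heteroclinic F G a b u w"
proof -
  have br: "branch F G a b p" and pe: "p a = 0" "p b = 0"
    using p by (auto simp: connection_def branch_def)
  note cp = branchD(1)[OF br] and pos = branchD(3)[OF br] and dp = branchD(4)[OF br]
  have ci: "isCont (\<lambda>x. 1 / p x) x" if "a < x" "x < b" for x
    using DERIV_isCont[OF dp[OF that]] pos[OF that] by (intro continuous_intros) auto
  obtain T where "\<forall>x. ereal a < ereal x \<longrightarrow> ereal x < ereal b \<longrightarrow> (T has_vector_derivative 1 / p x) (at x)"
    using einterval_antiderivative[of "ereal a" "ereal b" "\<lambda>x. 1 / p x"] ab ci by auto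
  then have dT: "(T has_real_derivative 1 / p x) (at x)" if "a < x" "x < b" for x
    using that by (simp add: has_real_derivative_iff_has_vector_derivative)
  have cT: "continuous_on {x..y} T" if "a < x" "y < b" for x y
    using that by (intro continuous_at_imp_continuous_on ballI DERIV_isCont[OF dT]) auto
  have T_less: "T x < T y" if xy: "a < x" "x < y" "y < b" for x y
  proof (rule DERIV_pos_imp_increasing[OF xy(2)])
    fix t assume "x \<le> t" "t \<le> y"
    with xy have t: "a < t" "t < b" by auto
    then show "\<exists>D. (T has_real_derivative D) (at t) \<and> 0 < D"
      using dT[OF t] pos[OF t] by (intro exI[of _ "1 / p t"]) simp
  qed
  define c where "c = (a + b) / 2"
  have c: "a < c" "c < b" using ab by (auto simp: c_def)
  have T_right: "T c + ln (b - c) / M \<le> T x + ln (b - x) / M" if x: "c \<le> x" "x < b" for x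
  proof (rule DERIV_nonneg_imp_nondecreasing[OF x(1)])
    fix y assume y: "c \<le> y" "y \<le> x"
    then have y': "a < y" "y < b" using c x by auto
    have "((\<lambda>x. T x + ln (b - x) / M) has_real_derivative 1 / p y + (1 / (b - y) * (0 - 1)) / M) (at y)"
      using y' M by (auto intro!: derivative_eq_intros dT)
    moreover have "1 / (M * (b - y)) \<le> 1 / p y"
      using pb[OF y'] pos[OF y'] y' M by (intro divide_left_mono) (auto intro: mult_pos_pos)
    then have "0 \<le> 1 / p y + (1 / (b - y) * (0 - 1)) / M" by (simp add: mult.commute)
    ultimately show "\<exists>D. ((\<lambda>x. T x + ln (b - x) / M) has_real_derivative D) (at y) \<and> 0 \<le> D" by blast
  qed
  have T_left: "T x - ln (x - a) / M \<le> T c - ln (c - a) / M" if x: "a < x" "x \<le> c" for x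
  proof (rule DERIV_nonneg_imp_nondecreasing[OF x(2)])
    fix y assume y: "x \<le> y" "y \<le> c"
    then have y': "a < y" "y < b" using c x by auto
    have "((\<lambda>x. T x - ln (x - a) / M) has_real_derivative 1 / p y - (1 / (y - a) * (1 - 0)) / M) (at y)"
      using y' M by (auto intro!: derivative_eq_intros dT)
    moreover have "1 / (M * (y - a)) \<le> 1 / p y"
      using pa[OF y'] pos[OF y'] y' M by (intro divide_left_mono) (auto intro: mult_pos_pos)
    then have "0 \<le> 1 / p y - (1 / (y - a) * (1 - 0)) / M" by (simp add: mult.commute)
    ultimately show "\<exists>D. ((\<lambda>x. T x - ln (x - a) / M) has_real_derivative D) (at y) \<and> 0 \<le> D" by blast
  qed
  have "\<exists>x. a < x \<and> x < b \<and> T x = z" for z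
  proof -
    \<comment> \<open>Shrinking the distance to an end by the factor \<open>E\<close> moves the logarithmic bound for \<open>T\<close>
      by exactly \<open>\<bar>z - T c\<bar>\<close>.\<close>
    define E where "E = exp (- (M * \<bar>z - T c\<bar>))"
    have E: "0 < E" "E \<le> 1" "ln E = - (M * \<bar>z - T c\<bar>)" using M by (auto simp: E_def)
    define x1 where "x1 = a + (c - a) * E"
    define x2 where "x2 = b - (b - c) * E"
    have le1: "(c - a) * E \<le> c - a" and le2: "(b - c) * E \<le> b - c"
      using E c by (auto simp: mult_le_cancel_left1)
    have x1: "a < x1" "x1 \<le> c" and x2: "c \<le> x2" "x2 < b"
      using le1 le2 mult_pos_pos[of "c - a" E] mult_pos_pos[of "b - c" E] E(1) c
      unfolding x1_def x2_def by linarith+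
    have "ln (x1 - a) = ln (c - a) - M * \<bar>z - T c\<bar>"
      using E c by (simp add: x1_def ln_mult)
    with T_left[OF x1] M have "T x1 \<le> T c - \<bar>z - T c\<bar>" by (simp add: diff_divide_distrib)
    moreover have "ln (b - x2) = ln (b - c) - M * \<bar>z - T c\<bar>"
      using E c by (simp add: x2_def ln_mult)
    with T_right[OF x2] M have "T c + \<bar>z - T c\<bar> \<le> T x2" by (simp add: diff_divide_distrib)
    ultimately have "T x1 \<le> z" "z \<le> T x2" by linarith+
    then obtain x where "x1 \<le> x" "x \<le> x2" "T x = z"
      using IVT'[of T x1 z x2] cT[of x1 x2] x1 x2 by auto
    with x1 x2 show ?thesis by (intro exI[of _ x]) auto
  qed
  then obtain u where u: "\<And>z. a < u z" "\<And>z. u z < b" "\<And>z. T (u z) = z" by metis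
  have uT: "u (T x) = x" if x: "a < x" "x < b" for x
    using T_less[of x "u (T x)"] T_less[of "u (T x)" x] u(1)[of "T x"] u(2)[of "T x"] u(3)[of "T x"] x
    by (cases x "u (T x)" rule: linorder_cases) auto
  have du: "(u has_real_derivative p (u z)) (at z)" for z
  proof -
    have "(u has_real_derivative inverse (1 / p (u z))) (at (T (u z)))"
    proof (rule DERIV_inverse_strong[where f=T and x="u z" and S="{a<..<b}"])
      show "continuous_on {a<..<b} T"
        by (intro continuous_at_imp_continuous_on ballI DERIV_isCont[OF dT]) auto
    qed (use dT u uT pos[of "u z"] in auto)
    then show ?thesis by (simp add: u(3))
  qed
  define w where "w z = p (u z)" for z
  have dw: "(w has_real_derivative G (u z) + F (u z) * w z) (at z)" for z
  proof -
    have "(w has_real_derivative (F (u z) + G (u z) / p (u z)) * p (u z)) (at z)"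
      unfolding w_def by (rule DERIV_chain2[OF dp du]) (use u in auto)
    moreover have "(F (u z) + G (u z) / p (u z)) * p (u z) = G (u z) + F (u z) * w z"
      using pos[of "u z"] u by (simp add: w_def field_simps)
    ultimately show ?thesis by simp
  qed
  have wpos: "0 < w z" for z unfolding w_def using pos u by blast
  have utop: "(u \<longlongrightarrow> b) at_top"
  proof (rule order_tendstoI)
    fix y assume y: "y < b"
    define x where "x = max y c"
    have x: "a < x" "x < b" using y c by (auto simp: x_def)
    show "\<forall>\<^sub>F z in at_top. y < u z"
      using eventually_gt_at_top[of "T x"]
    proof eventually_elim
      case (elim z)
      then have "x < u z"
        using T_less[of "u z" x] u[of z] x by (cases x "u z" rule: linorder_cases) auto
      then show ?case by (simp add: x_def)
    qed
  qed (use u(2) in \<open>auto intro: always_eventually less_trans\<close>)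
  have ubot: "(u \<longlongrightarrow> a) at_bot"
  proof (rule order_tendstoI)
    fix y assume y: "a < y"
    define x where "x = min y c"
    have x: "a < x" "x < b" using y c by (auto simp: x_def)
    show "\<forall>\<^sub>F z in at_bot. u z < y"
      using eventually_gt_at_bot[of "T x"]
    proof eventually_elim
      case (elim z)
      then have "u z < x"
        using T_less[of x "u z"] u[of z] x by (cases x "u z" rule: linorder_cases) auto
      then show ?case by (simp add: x_def)
    qed
  qed (use u(1) in \<open>auto intro: always_eventually less_trans\<close>)
  have "filterlim u (at_left b) at_top" "filterlim u (at_right a) at_bot"
    unfolding filterlim_at using u utop ubot by (auto simp: less_imp_neq less_imp_neq[symmetric])
  moreover have "(p \<longlongrightarrow> 0) (at_left b)" "(p \<longlongrightarrow> 0) (at_right a)"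
    using continuous_on_Icc_at_leftD[OF cp ab] continuous_on_Icc_at_rightD[OF cp ab] pe by auto
  ultimately have "(w \<longlongrightarrow> 0) at_top" "(w \<longlongrightarrow> 0) at_bot"
    unfolding w_def by (auto intro: filterlim_compose)
  then have "heteroclinic F G a b u w"
    unfolding heteroclinic_def using du dw wpos utop ubot by (auto simp: w_def)
  then show ?thesis by blast
qed

lemma heteroclinic_iff_connection:
  assumes ab: "a < b" and F: "continuous_on {a..b} F" and G: "continuous_on {a..b} G"
    and Gzero: "G a = 0" "G b = 0"
    and dG: "(G has_real_derivative Ga) (at a)" "(G has_real_derivative Gb) (at b)"
  shows "(\<exists>u w. heteroclinic F G a b u w) \<longleftrightarrow> (\<exists>p. connection F G a b p)"
proof
  assume "\<exists>u w. heteroclinic F G a b u w"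
  then show "\<exists>p. connection F G a b p" using heteroclinic_imp_connection[OF _ ab] by blast
next
  assume "\<exists>p. connection F G a b p"
  then obtain p where p: "connection F G a b p" by blast
  then have br: "branch F G a b p" by (simp add: connection_def)
  have rbr: "branch (\<lambda>s. - F (- s)) (\<lambda>s. - G (- s)) (- b) (- a) (\<lambda>s. p (- s))"
    using p by (intro branch_reflect) (auto simp: connection_def branch_def)
  have "bounded (F ` {a..b})" by (intro compact_imp_bounded compact_continuous_image F) auto
  then obtain C where C: "0 < C" "\<And>u. u \<in> {a..b} \<Longrightarrow> \<bar>F u\<bar> \<le> C" unfolding bounded_pos by auto
  have Fle: "F u \<le> C" "- F u \<le> C" if "u \<in> {a..b}" for u using C(2)[OF that] by auto
  obtain L where L: "0 \<le> L" "\<And>u. u \<in> {a..b} \<Longrightarrow> G u \<le> L * (u - a)"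
    using linear_bound_at_zero[OF _ G Gzero(1) dG(1)] ab by auto
  have cRG: "continuous_on {- b..- a} (\<lambda>s. - G (- s))"
    by (intro continuous_on_minus continuous_on_compose2[OF G]) (auto intro!: continuous_intros)
  have dRG: "((\<lambda>s. - G (- s)) has_real_derivative Gb) (at (- b))"
  proof -
    have "((\<lambda>s. G (- s)) has_real_derivative Gb * (- 1)) (at (- b))"
      by (rule DERIV_chain2[where g=uminus]) (use dG(2) in \<open>auto intro!: derivative_eq_intros\<close>)
    from DERIV_minus[OF this] show ?thesis by simp
  qed
  obtain L' where L': "0 \<le> L'" "\<And>s. s \<in> {- b..- a} \<Longrightarrow> - G (- s) \<le> L' * (s - - b)"
    using linear_bound_at_zero[OF _ cRG _ dRG] ab Gzero(2) by auto
  define M where "M = C + max L L' + 1"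
  have M: "0 < M" "C + L + 1 \<le> M" "C + L' + 1 \<le> M" using C L by (auto simp: M_def)
  have pa: "p x \<le> M * (x - a)" if x: "a < x" "x < b" for x
  proof -
    have "p x \<le> (C + L + 1) * (x - a)"
      by (rule branch_le_linear[OF br less_imp_le[OF C(1)] L(1)]) (use Fle(1) L(2) x in auto)
    also have "\<dots> \<le> M * (x - a)" using M x by (intro mult_right_mono) auto
    finally show ?thesis .
  qed
  have pb: "p x \<le> M * (b - x)" if x: "a < x" "x < b" for x
  proof -
    have "p (- (- x)) \<le> (C + L' + 1) * (- x - - b)"
      by (rule branch_le_linear[OF rbr less_imp_le[OF C(1)] L'(1) L'(2) Fle(2)]) (use x in auto)
    also have "\<dots> \<le> M * (- x - - b)" using M x by (intro mult_right_mono) auto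
    finally show ?thesis by simp
  qed
  show "\<exists>u w. heteroclinic F G a b u w"
    by (rule connection_imp_heteroclinic[OF p ab M(1) pa pb])
qed

text \<open>
  Reversing the direction of \<open>z\<close> and the sign of \<open>w\<close> keeps \<open>u' = w\<close> and changes the sign of the
  damping term only. Orbits running downwards from \<open>b\<close> to \<open>a\<close> are thereby reduced to upward ones.
\<close>
lemma heteroclinic_reversed_iff:
  "heteroclinic F G a b (\<lambda>z. u (- z)) (\<lambda>z. - w (- z)) \<longleftrightarrow>
     (\<forall>z. (u has_real_derivative w z) (at z) \<and>
          (w has_real_derivative G (u z) - F (u z) * w z) (at z) \<and> w z < 0) \<and>
     (u \<longlongrightarrow> b) at_bot \<and> (u \<longlongrightarrow> a) at_top \<and> (w \<longlongrightarrow> 0) at_bot \<and> (w \<longlongrightarrow> 0) at_top"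
proof -
  have "((\<lambda>z. u (- z)) has_real_derivative - w (- z)) (at z) \<longleftrightarrow>
      (u has_real_derivative w (- z)) (at (- z))" for z
    using DERIV_mirror[of u "w (- z)" z] by simp
  moreover have "((\<lambda>z. - w (- z)) has_real_derivative G (u (- z)) + F (u (- z)) * (- w (- z))) (at z) \<longleftrightarrow>
      (w has_real_derivative G (u (- z)) - F (u (- z)) * w (- z)) (at (- z))" for z
    using DERIV_mirror[of "\<lambda>z. - w z" "- (G (u (- z)) - F (u (- z)) * w (- z))" z]
      DERIV_minus[of w "G (u (- z)) - F (u (- z)) * w (- z)" "- z" UNIV]
      DERIV_minus[of "\<lambda>z. - w z" "- (G (u (- z)) - F (u (- z)) * w (- z))" "- z" UNIV]
    by auto
  moreover have "(\<forall>z. P (- z)) \<longleftrightarrow> (\<forall>z. P z)" for P :: "real \<Rightarrow> bool"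
    by (metis minus_minus)
  ultimately have *: "(\<forall>z. ((\<lambda>z. u (- z)) has_real_derivative - w (- z)) (at z) \<and>
        ((\<lambda>z. - w (- z)) has_real_derivative G (u (- z)) + F (u (- z)) * (- w (- z))) (at z) \<and>
        0 < - w (- z)) \<longleftrightarrow>
      (\<forall>z. (u has_real_derivative w z) (at z) \<and>
          (w has_real_derivative G (u z) - F (u z) * w z) (at z) \<and> w z < 0)"
    by (smt (verit, best))
  have w0: "((\<lambda>z. - w (- z)) \<longlongrightarrow> 0) X \<longleftrightarrow> ((\<lambda>z. w (- z)) \<longlongrightarrow> 0) X" for X
    using tendsto_minus_cancel_left[of "\<lambda>z. w (- z)" 0 X] by simp
  show ?thesis
    unfolding heteroclinic_def * w0
    by (auto simp: filterlim_at_top_mirror[of u] filterlim_at_bot_mirror[of u]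
        filterlim_at_top_mirror[of w] filterlim_at_bot_mirror[of w])
qed

section \<open>The zeros of the nonlinearity\<close>

text \<open>
  \<open>V'\<close> takes no value twice on \<open>[0, U]\<close>, nor on \<open>[U, \<infinity>)\<close>, because \<open>V''\<close> has no zero in between
  (Rolle). A pair of points in the wrong order would, by the intermediate value theorem and the maximality of
  \<open>V' U\<close>, produce a repeated value.
\<close>
lemma bell_shaped_derivative:
  fixes V' V'' :: "real \<Rightarrow> real"
  assumes cont: "continuous_on {0..} V'"
    and deriv: "\<And>u. 0 < u \<Longrightarrow> (V' has_real_derivative V'' u) (at u)"
    and U: "0 < U" and max: "\<And>u. 0 \<le> u \<Longrightarrow> V' u \<le> V' U"
    and root: "\<And>u. 0 < u \<Longrightarrow> V'' u = 0 \<longleftrightarrow> u = U"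
  shows "0 \<le> x \<Longrightarrow> x < y \<Longrightarrow> y \<le> U \<Longrightarrow> V' x < V' y"
    and "U \<le> x \<Longrightarrow> x < y \<Longrightarrow> V' y < V' x"
proof -
  have c: "continuous_on {s..t} V'" if "0 \<le> s" for s t
    by (rule continuous_on_subset[OF cont]) (use that in auto)
  have rolle: "\<exists>z. s < z \<and> z < t \<and> z = U" if st: "0 \<le> s" "s < t" "V' s = V' t" for s t
  proof -
    have "\<exists>z. s < z \<and> z < t \<and> V'' z = 0"
      using MVT[of s t V'] st c[of s t] deriv
      by (smt (verit, best) DERIV_unique mult_eq_0_iff real_differentiable_def)
    then obtain z where z: "s < z" "z < t" "V'' z = 0" by blast
    with root[of z] st show ?thesis by auto
  qed
  show "V' x < V' y" if xy: "0 \<le> x" "x < y" "y \<le> U"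
  proof (rule ccontr)
    assume "\<not> V' x < V' y"
    then obtain t where "y \<le> t" "t \<le> U" "V' t = V' x"
      using IVT'[of V' y "V' x" U] max[of x] c[of y U] xy by auto
    with rolle[of x t] xy show False by auto
  qed
  show "V' y < V' x" if xy: "U \<le> x" "x < y"
  proof (rule ccontr)
    assume "\<not> V' y < V' x"
    then obtain t where "U \<le> t" "t \<le> x" "V' t = V' y"
      using IVT2'[of V' x "V' y" U] max[of y] c[of U x] xy U by auto
    with rolle[of t y] xy U show False by auto
  qed
qed

lemma strict_increasing_interior:
  fixes \<phi> :: "real \<Rightarrow> real"
  assumes "x < y" "continuous_on {x..y} \<phi>"
    and "\<And>u. x < u \<Longrightarrow> u < y \<Longrightarrow> (\<phi> has_real_derivative D u) (at u) \<and> 0 < D u"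
  shows "\<phi> x < \<phi> y"
  by (rule DERIV_pos_imp_increasing_open[OF assms(1) _ assms(2)]) (use assms(3) in blast)

lemma ordered_triple_ends_unique:
  fixes a m b x y z :: "'a::linorder"
  assumes "{a, m, b} = {x, y, z}" "a < m" "m < b" "x < y" "y < z"
  shows "a = x" "b = z"
proof -
  have "Min {a, m, b} = Min {x, y, z}" "Max {a, m, b} = Max {x, y, z}" using assms(1) by simp_all
  moreover have "a < b" "x < z" using assms(2-5) by (auto intro: less_trans)
  ultimately show "a = x" "b = z"
    using assms(2-5) by (simp_all add: min.absorb1 max.absorb2 less_imp_le)
qed

text \<open>
  As \<open>V'\<close> is bell-shaped and \<open>V' 0 < K < V' U\<close>, the line \<open>K\<close> cuts its graph exactly twice, at \<open>xM < U < xm\<close>. So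
  \<open>\<phi> u = K * u - V u\<close> increases up to \<open>xM\<close>, decreases up to \<open>xm\<close> and increases to infinity afterwards. The
  bounds on \<open>c\<close> say that the level \<open>c\<close> lies above \<open>\<phi> 0\<close> and \<open>\<phi> xm\<close> and below \<open>\<phi> xM\<close>, hence is met
  once on each monotone piece.
\<close>
lemma D1_three_zeros:
  fixes V V' V'' :: "real \<Rightarrow> real"
  assumes V_deriv: "\<And>u. u \<ge> 0 \<Longrightarrow> (V has_real_derivative V' u) (at u within {0..})"
    and V'_cont: "continuous_on {0..} V'"
    and V'_deriv: "\<And>u. u > 0 \<Longrightarrow> (V' has_real_derivative V'' u) (at u)"
    and V'_pos: "\<And>u. u > 0 \<Longrightarrow> V' u > 0"
    and V'_lim: "(V' \<longlongrightarrow> 0) at_top"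
    and U: "0 < U" and max: "\<And>u. 0 \<le> u \<Longrightarrow> V' u \<le> V' U"
    and root: "\<And>u. 0 < u \<Longrightarrow> V'' u = 0 \<longleftrightarrow> u = U"
    and Kc: "(K, c) \<in> D1 V V' U"
  obtains a m b where "0 < K" "0 < a" "a < m" "m < b" "u_one V K c = a" "u_two V K c = b"
    "f_fun V K c a = 0" "f_fun V K c m = 0" "f_fun V K c b = 0" "K < V' m"
    "\<forall>u\<in>{a<..<m}. 0 < f_fun V K c u" "\<forall>u\<in>{m<..<b}. f_fun V K c u < 0"
proof -
  note bell = bell_shaped_derivative[OF V'_cont V'_deriv U max root]
  have K: "V' 0 < K" "K < V' U" and c_lo: "c_one V K < c" and c_hi: "c < c_max V K"
    using Kc by (auto simp: D1_def)
  have cV': "continuous_on {s..t} V'" if "0 \<le> s" for s t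
    by (rule continuous_on_subset[OF V'_cont]) (use that in auto)
  have "0 \<le> V' 0"
  proof (rule ccontr)
    assume neg: "\<not> 0 \<le> V' 0"
    then obtain t where t: "0 \<le> t" "t \<le> U" "V' t = V' 0 / 2"
      using IVT'[of V' 0 "V' 0 / 2" U] cV'[of 0 U] V'_pos[OF U] U by auto
    with neg V'_pos[of t] show False by (cases "t = 0") auto
  qed
  with K have K0: "0 < K" by simp
  obtain xM where xM: "0 \<le> xM" "xM \<le> U" "V' xM = K"
    using IVT'[of V' 0 K U] cV'[of 0 U] K U by auto
  then have xM': "0 < xM" "xM < U" using K by (metis less_eq_real_def less_irrefl)+
  have "\<forall>\<^sub>F u in at_top. V' u < K / 2" by (rule order_tendstoD(2)[OF V'_lim]) (use K0 in simp)
  then obtain Y where Y: "\<And>u. Y \<le> u \<Longrightarrow> V' u < K / 2" by (auto simp: eventually_at_top_linorder)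
  define y where "y = max Y (U + 1)"
  have y: "U < y" "V' y < K / 2" using Y by (auto simp: y_def)
  obtain xm where xm: "U \<le> xm" "xm \<le> y" "V' xm = K"
    using IVT2'[of V' y K U] cV'[of U y] K y K0 U by auto
  then have xm': "U < xm" "xm < y" using K y K0 by (auto simp: less_eq_real_def)
  have sign1: "V' u < K" if "0 \<le> u" "u < xM" for u using bell(1)[of u xM] that xM by simp
  have sign2: "K < V' u" if "xM < u" "u < xm" for u
    using bell(1)[of xM u] bell(2)[of u xm] that xM xm by (cases "u \<le> U") auto
  have sign3: "V' u < K" if "xm < u" for u using bell(2)[of xm u] that xm by simp
  define \<phi> where "\<phi> u = K * u - V u" for u
  have c\<phi>: "continuous_on {s..t} \<phi>" if "0 \<le> s" for s t
  proof -
    have "continuous_on {0..} V" using V_deriv by (intro DERIV_continuous_on) auto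
    then show ?thesis
      unfolding \<phi>_def by (intro continuous_intros) (rule continuous_on_subset, use that in auto)
  qed
  have dV: "(V has_real_derivative V' u) (at u)" if "0 < u" for u
  proof -
    have "(V has_real_derivative V' u) (at u within {0<..})"
      by (rule has_field_derivative_subset[OF V_deriv]) (use that in auto)
    then show ?thesis using that by (simp add: at_within_open[OF _ open_greaterThan])
  qed
  have d\<phi>: "(\<phi> has_real_derivative K - V' u) (at u)" if "0 < u" for u
    unfolding \<phi>_def by (rule derivative_eq_intros dV that refl | simp)+
  have inc1: "\<phi> s < \<phi> t" if "0 \<le> s" "s < t" "t \<le> xM" for s t
    by (rule strict_increasing_interior[where D="\<lambda>u. K - V' u"]) (use that c\<phi> d\<phi> sign1 in auto)
  have dec2: "\<phi> t < \<phi> s" if "xM \<le> s" "s < t" "t \<le> xm" for s t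
  proof -
    have "((\<lambda>u. - \<phi> u) has_real_derivative V' u - K) (at u)" if "0 < u" for u
      using DERIV_minus[OF d\<phi>[OF that]] by simp
    then have "- \<phi> s < - \<phi> t"
      by (intro strict_increasing_interior[where \<phi>="\<lambda>u. - \<phi> u" and D="\<lambda>u. V' u - K"])
        (use that c\<phi> xM' sign2 in \<open>auto intro!: continuous_intros\<close>)
    then show ?thesis by simp
  qed
  have inc3: "\<phi> s < \<phi> t" if "xm \<le> s" "s < t" for s t
    by (rule strict_increasing_interior[where D="\<lambda>u. K - V' u"]) (use that c\<phi> d\<phi> sign3 xm' U in auto)
  have crit: "x = xM \<or> x = xm" if x: "0 < x" "V' x = K" for x
    using sign1[of x] sign2[of x] sign3[of x] x by (cases x xM rule: linorder_cases; cases x xm rule: linorder_cases) auto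
  have left: "\<forall>\<^sub>F t in at_left x. P t" if "\<forall>\<^sub>F t in nhds x. P t" for P and x :: real
    using that at_within_le_nhds filter_leD by blast
  have "u_max V K = xM"
    unfolding u_max_def \<phi>_def[symmetric]
  proof (rule the_equality)
    have "\<forall>\<^sub>F t in nhds xM. t \<in> {0<..<xm}" by (rule eventually_nhds_in_open) (use xM' xm' in auto)
    then have "\<forall>\<^sub>F t in nhds xM. \<phi> t \<le> \<phi> xM"
    proof eventually_elim
      case (elim t)
      then show ?case using inc1[of t xM] dec2[of xM t] by (cases t xM rule: linorder_cases) auto
    qed
    then show "0 < xM \<and> local_max_point \<phi> xM" using xM' by (simp add: local_max_point_def)
    fix x assume x: "0 < x \<and> local_max_point \<phi> x"
    then have ev: "\<forall>\<^sub>F t in nhds x. \<phi> t \<le> \<phi> x" by (simp add: local_max_point_def)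
    then obtain d where "0 < d" "\<forall>t. \<bar>x - t\<bar> < d \<longrightarrow> \<phi> t \<le> \<phi> x"
      by (auto simp: eventually_nhds_metric dist_real_def abs_minus_commute)
    then have "K - V' x = 0" using DERIV_local_max[OF d\<phi>] x by blast
    then have "x = xM \<or> x = xm" using crit x by simp
    moreover have "x \<noteq> xm"
    proof
      assume "x = xm"
      have "xM < xm" using xM' xm' by simp
      have "\<forall>\<^sub>F t in at_left xm. False"
        using left[OF ev] eventually_at_left_real[OF \<open>xM < xm\<close>] unfolding \<open>x = xm\<close>
      proof eventually_elim
        case (elim t)
        then show ?case using dec2[of t xm] by simp
      qed
      then show False by simp
    qed
    ultimately show "x = xM" by simp
  qed
  moreover have "u_min V K = xm"
    unfolding u_min_def \<phi>_def[symmetric]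
  proof (rule the_equality)
    have "\<forall>\<^sub>F t in nhds xm. t \<in> {xM<..}" by (rule eventually_nhds_in_open) (use xM' xm' in auto)
    then have "\<forall>\<^sub>F t in nhds xm. \<phi> xm \<le> \<phi> t"
    proof eventually_elim
      case (elim t)
      then show ?case using dec2[of t xm] inc3[of xm t] by (cases t xm rule: linorder_cases) auto
    qed
    then show "0 < xm \<and> local_min_point \<phi> xm" using xm' U by (simp add: local_min_point_def)
    fix x assume x: "0 < x \<and> local_min_point \<phi> x"
    then have ev: "\<forall>\<^sub>F t in nhds x. \<phi> x \<le> \<phi> t" by (simp add: local_min_point_def)
    then obtain d where "0 < d" "\<forall>t. \<bar>x - t\<bar> < d \<longrightarrow> \<phi> x \<le> \<phi> t"
      by (auto simp: eventually_nhds_metric dist_real_def abs_minus_commute)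
    then have "K - V' x = 0" using DERIV_local_min[OF d\<phi>] x by blast
    then have "x = xM \<or> x = xm" using crit x by simp
    moreover have "x \<noteq> xM"
    proof
      assume "x = xM"
      have "\<forall>\<^sub>F t in at_left xM. False"
        using left[OF ev] eventually_at_left_real[OF xM'(1)] unfolding \<open>x = xM\<close>
      proof eventually_elim
        case (elim t)
        then show ?case using inc1[of t xM] by simp
      qed
      then show False by simp
    qed
    ultimately show "x = xm" by simp
  qed
  ultimately have cs: "\<phi> 0 < c" "\<phi> xm < c" "c < \<phi> xM"
    using c_lo c_hi by (auto simp: c_one_def c_zero_def c_min_def c_max_def \<phi>_def)
  obtain a where a: "0 \<le> a" "a \<le> xM" "\<phi> a = c"
    using IVT'[of \<phi> 0 c xM] c\<phi>[of 0 xM] cs xM by auto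
  have a': "0 < a" "a < xM" using a cs by (auto simp: less_eq_real_def)
  obtain m where m: "xM \<le> m" "m \<le> xm" "\<phi> m = c"
    using IVT2'[of \<phi> xm c xM] c\<phi>[of xM xm] cs xM' xm' by auto
  have m': "xM < m" "m < xm" using m cs by (auto simp: less_eq_real_def)
  \<comment> \<open>Beyond \<open>y\<close> the slope of \<open>\<phi>\<close> is at least \<open>K / 2\<close>, which makes up for the deficit
    \<open>c - \<phi> y\<close> at \<open>t\<close>.\<close>
  define t where "t = y + 2 * \<bar>c - \<phi> y\<bar> / K"
  have yt: "y \<le> t" using K0 by (simp add: t_def)
  have "\<phi> y - K / 2 * y \<le> \<phi> t - K / 2 * t"
  proof (rule DERIV_nonneg_imp_nondecreasing[OF yt])
    fix u assume u: "y \<le> u" "u \<le> t"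
    then have u': "0 < u" using y U by simp
    have "((\<lambda>u. \<phi> u - K / 2 * u) has_real_derivative (K - V' u) - K / 2) (at u)"
      by (rule derivative_eq_intros d\<phi> u' refl | simp)+
    moreover have "0 \<le> (K - V' u) - K / 2" using Y[of u] u by (simp add: y_def)
    ultimately show "\<exists>D. ((\<lambda>u. \<phi> u - K / 2 * u) has_real_derivative D) (at u) \<and> 0 \<le> D" by blast
  qed
  moreover have "K / 2 * t = K / 2 * y + \<bar>c - \<phi> y\<bar>" using K0 by (simp add: t_def field_simps)
  ultimately have "c \<le> \<phi> t" by linarith
  then obtain b where b: "xm \<le> b" "\<phi> b = c"
    using IVT'[of \<phi> xm c t] c\<phi>[of xm t] cs xm' U yt by auto
  have b': "xm < b" using b cs by (auto simp: less_eq_real_def)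
  have f: "f_fun V K c u = (\<phi> u - c) / K" for u by (simp add: f_fun_def \<phi>_def)
  have order: "0 < a" "a < m" "m < b" using a' m' b' by auto
  have only: "u = a \<or> u = m \<or> u = b" if u: "0 < u" "\<phi> u = c" for u
  proof -
    consider "u \<le> xM" | "xM < u" "u \<le> xm" | "xm < u" by linarith
    then show ?thesis
    proof cases
      case 1
      then show ?thesis using inc1[of u a] inc1[of a u] u a by (cases u a rule: linorder_cases) auto
    next
      case 2
      then show ?thesis using dec2[of u m] dec2[of m u] u m by (cases u m rule: linorder_cases) auto
    next
      case 3
      then show ?thesis using inc3[of u b] inc3[of b u] u b by (cases u b rule: linorder_cases) auto
    qed
  qed
  have zeros: "{u. 0 < u \<and> f_fun V K c u = 0} = {a, m, b}"
    using only order a m b K0 by (auto simp: f)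
  have tz: "three_zeros V K c a m b" using order zeros by (simp add: three_zeros_def)
  have uniq: "x1 = a \<and> x2 = b" if "three_zeros V K c x1 x0 x2" for x1 x0 x2
    using that zeros order ordered_triple_ends_unique[of x1 x0 x2 a m b] by (auto simp: three_zeros_def)
  show ?thesis
  proof
    show "u_one V K c = a" unfolding u_one_def by (rule the_equality) (use tz uniq in blast)+
    show "u_two V K c = b" unfolding u_two_def by (rule the_equality) (use tz uniq in blast)+
    show "\<forall>u\<in>{a<..<m}. 0 < f_fun V K c u"
    proof
      fix u assume u: "u \<in> {a<..<m}"
      then show "0 < f_fun V K c u"
        using inc1[of a u] dec2[of u m] a a' m m' K0 by (cases "u \<le> xM") (auto simp: f)
    qed
    show "\<forall>u\<in>{m<..<b}. f_fun V K c u < 0"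
    proof
      fix u assume u: "u \<in> {m<..<b}"
      then show "f_fun V K c u < 0"
        using dec2[of m u] inc3[of u b] b b' m m' K0
        by (cases "u \<le> xm") (auto simp: f divide_less_0_iff)
    qed
  qed (use K0 order a m b m' sign2 in \<open>auto simp: f\<close>)
qed

section \<open>Heteroclinic orbits of the planar system\<close>

lemma C1_coefficients:
  fixes \<kappa> :: "real \<Rightarrow> real"
  assumes "\<tau> > 0" and C1: "\<kappa> C1_differentiable_on {0<..}" and pos: "\<And>x. x > 0 \<Longrightarrow> \<kappa> x > 0"
    and u: "u > 0"
  shows "0 < g1_fun \<tau> \<kappa> u" "0 < g2_fun \<tau> \<kappa> u"
    "\<exists>D. (g1_fun \<tau> \<kappa> has_real_derivative D) (at u)" "\<exists>D. (g2_fun \<tau> \<kappa> has_real_derivative D) (at u)"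
proof -
  have k: "0 < \<kappa> (inverse u)" using pos u by simp
  have "inverse u \<in> {0<..}" using u by simp
  with C1 obtain D where "(\<kappa> has_real_derivative D) (at (inverse u))"
    unfolding C1_differentiable_on_def has_real_derivative_iff_has_vector_derivative by blast
  then have dk: "((\<lambda>u. \<kappa> (inverse u)) has_real_derivative D * - (inverse u ^ Suc (Suc 0))) (at u)"
    using u by (intro DERIV_chain2 DERIV_inverse) auto
  show "0 < g1_fun \<tau> \<kappa> u" "0 < g2_fun \<tau> \<kappa> u"
    using k u assms(1) by (auto simp: g1_fun_def g2_fun_def)
  have dden: "((\<lambda>u. t * \<kappa> (inverse u)) has_real_derivative t * (D * - (inverse u ^ Suc (Suc 0)))) (at u)" for t
    by (rule DERIV_cmult[OF dk])
  have nz: "t * \<kappa> (inverse u) \<noteq> 0" if "0 < t" for t using k that by simp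
  show "\<exists>D. (g1_fun \<tau> \<kappa> has_real_derivative D) (at u)"
    using DERIV_divide[OF DERIV_const[of 1] dden[of \<tau>]] nz[of \<tau>] assms(1)
    unfolding g1_fun_def[abs_def] by blast
  show "\<exists>D. (g2_fun \<tau> \<kappa> has_real_derivative D) (at u)"
    using DERIV_divide[OF DERIV_ident dden[of "2 * \<tau>"]] nz[of "2 * \<tau>"] assms(1)
    unfolding g2_fun_def[abs_def] by auto
qed

theorem theorem1:
  fixes \<tau> U\<^sub>M K c :: real and V V' V'' \<kappa> :: "real \<Rightarrow> real"
  assumes tau_pos: "\<tau> > 0"
    and V_deriv: "\<And>u. u \<ge> 0 \<Longrightarrow> (V has_real_derivative V' u) (at u within {0..})"
    and V'_cont: "continuous_on {0..} V'"
    and V'_deriv: "\<And>u. u > 0 \<Longrightarrow> (V' has_real_derivative V'' u) (at u)"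
    and V''_cont: "continuous_on {0<..} V''"
    and V'_pos: "\<And>u. u > 0 \<Longrightarrow> V' u > 0"
    and V'_bounded: "bounded (V' ` {0<..})"
    and V'_lim: "(V' \<longlongrightarrow> 0) at_top"
    and UM_pos: "U\<^sub>M > 0"
    and UM_max: "\<And>u. u \<ge> 0 \<Longrightarrow> V' u \<le> V' U\<^sub>M"
    and UM_root: "\<And>u. u > 0 \<Longrightarrow> V'' u = 0 \<longleftrightarrow> u = U\<^sub>M"
    and kappa_C1: "\<kappa> C1_differentiable_on {0<..}"
    and kappa_pos: "\<And>x. x > 0 \<Longrightarrow> \<kappa> x > 0"
    and Kc: "(K, c) \<in> D1 V V' U\<^sub>M"
  shows "(\<exists>\<mu>\<^sub>b::real. \<forall>\<mu>.
            (\<exists>u w. solves_S \<tau> \<kappa> V K c \<mu> u w \<and>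
                   (u \<longlongrightarrow> u_one V K c) at_bot \<and> (u \<longlongrightarrow> u_two V K c) at_top \<and>
                   (w \<longlongrightarrow> 0) at_bot \<and> (w \<longlongrightarrow> 0) at_top \<and> (\<forall>z. w z > 0))
            \<longleftrightarrow> \<mu> = \<mu>\<^sub>b) \<and>
         (\<exists>\<mu>\<^sub>f::real. \<forall>\<mu>.
            (\<exists>u w. solves_S \<tau> \<kappa> V K c \<mu> u w \<and>
                   (u \<longlongrightarrow> u_two V K c) at_bot \<and> (u \<longlongrightarrow> u_one V K c) at_top \<and>
                   (w \<longlongrightarrow> 0) at_bot \<and> (w \<longlongrightarrow> 0) at_top \<and> (\<forall>z. w z < 0))
            \<longleftrightarrow> \<mu> = \<mu>\<^sub>f)"
proof -
  obtain a m b where K: "0 < K" and amb: "0 < a" "a < m" "m < b"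
    and ends: "u_one V K c = a" "u_two V K c = b"
    and zeros: "f_fun V K c a = 0" "f_fun V K c m = 0" "f_fun V K c b = 0"
    and Vm: "K < V' m"
    and fpos: "\<forall>u\<in>{a<..<m}. 0 < f_fun V K c u" and fneg: "\<forall>u\<in>{m<..<b}. f_fun V K c u < 0"
    by (rule D1_three_zeros[OF V_deriv V'_cont V'_deriv V'_pos V'_lim UM_pos UM_max UM_root Kc]) blast
  have coeff: "0 < g1_fun \<tau> \<kappa> u" "0 < g2_fun \<tau> \<kappa> u"
    "\<exists>D. (g1_fun \<tau> \<kappa> has_real_derivative D) (at u)" "\<exists>D. (g2_fun \<tau> \<kappa> has_real_derivative D) (at u)"
    if "0 < u" for u
    using C1_coefficients[OF tau_pos kappa_C1 kappa_pos that] by blast+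
  \<comment> \<open>In this notation the system is \<open>w' = G u + (A u + \<mu> * B u) * w\<close>.\<close>
  define f where "f = f_fun V K c"
  define B where "B = g2_fun \<tau> \<kappa>"
  define G where "G u = g1_fun \<tau> \<kappa> u * f u" for u
  define A where "A u = B u * deriv f u" for u
  have df: "(f has_real_derivative (K - V' u) / K) (at u)" if u: "0 < u" for u
  proof -
    have "(V has_real_derivative V' u) (at u within {0<..})"
      by (rule has_field_derivative_subset[OF V_deriv]) (use u in auto)
    then have "(V has_real_derivative V' u) (at u)"
      using u by (simp add: at_within_open[OF _ open_greaterThan])
    then show ?thesis
      unfolding f_def f_fun_def[abs_def] using K by (auto intro!: derivative_eq_intros)
  qed
  have dB: "\<exists>D. (B has_real_derivative D) (at u)" if "0 < u" for u
    unfolding B_def by (rule coeff(4)[OF that])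
  have dG: "\<exists>D. (G has_real_derivative D) (at u)" if u: "0 < u" for u
    unfolding G_def using coeff(3)[OF u] DERIV_mult[OF _ df[OF u]] by blast
  have dA: "\<exists>D. (A has_real_derivative D) (at u)" if u: "0 < u" for u
  proof -
    obtain D where D: "(B has_real_derivative D) (at u)" using dB[OF u] by blast
    have "((\<lambda>u. (K - V' u) / K) has_real_derivative (0 - V'' u) / K) (at u)"
      by (intro DERIV_cdivide DERIV_diff DERIV_const V'_deriv u)
    from DERIV_mult[OF D this]
    have "(A has_real_derivative D * ((K - V' u) / K) + (0 - V'' u) / K * B u) (at u)"
      by (rule has_field_derivative_transform_within_open[OF _ open_greaterThan[of 0]])
        (use u DERIV_imp_deriv[OF df] in \<open>auto simp: A_def\<close>)
    then show ?thesis by blast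
  qed
  have cont: "continuous_on {a..b} F" if "\<And>u. 0 < u \<Longrightarrow> \<exists>D. (F has_real_derivative D) (at u)" for F
  proof (intro continuous_at_imp_continuous_on ballI)
    fix x assume "x \<in> {a..b}"
    with amb have "0 < x" by simp
    then show "isCont F x" using that DERIV_isCont by blast
  qed
  have cA: "continuous_on {a..b} A" and cB: "continuous_on {a..b} B" and cG: "continuous_on {a..b} G"
    by (intro cont dA dB dG; assumption)+
  have Gzero: "G a = 0" "G m = 0" "G b = 0" using zeros by (auto simp: G_def f_def)
  have ab: "a < b" "0 < m" "0 < b" using amb by auto
  obtain Ga Gb where Ga: "(G has_real_derivative Ga) (at a)" and Gb: "(G has_real_derivative Gb) (at b)"
    using dG amb ab by metis
  obtain A' B' where A': "(A has_real_derivative A') (at m)" and B': "(B has_real_derivative B') (at m)"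
    using dA dB ab by metis
  obtain Gm where Gm: "(G has_real_derivative Gm) (at m)" "Gm < 0"
  proof -
    obtain D where "(g1_fun \<tau> \<kappa> has_real_derivative D) (at m)" using coeff(3)[OF ab(2)] by blast
    from DERIV_mult[OF this df[OF ab(2)]]
    have "(G has_real_derivative (K - V' m) / K * g1_fun \<tau> \<kappa> m) (at m)"
      using zeros(2) by (simp add: G_def[abs_def] f_def)
    moreover have "(K - V' m) / K * g1_fun \<tau> \<kappa> m < 0"
      using Vm K coeff(1)[OF ab(2)] by (intro mult_neg_pos divide_neg_pos) auto
    ultimately show ?thesis by (rule that)
  qed
  have Bpos: "0 < B u" if "u \<in> {a..b}" for u unfolding B_def using coeff(2)[of u] that amb by auto
  have Gpos: "0 < G u" if "a < u" "u < m" for u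
    unfolding G_def f_def using coeff(1)[of u] fpos that amb by auto
  have Gneg: "G u < 0" if "m < u" "u < b" for u
    unfolding G_def f_def using coeff(1)[of u] fneg that ab by (intro mult_pos_neg) auto
  have cF: "continuous_on {a..b} (\<lambda>u. A u + \<mu> * B u)" "continuous_on {a..b} (\<lambda>u. - A u + \<mu> * B u)" for \<mu>
    by (intro continuous_intros cA cB)+
  note orbit_iff = heteroclinic_iff_connection[OF ab(1) _ cG Gzero(1,3) Ga Gb]
  have vf: "g1_fun \<tau> \<kappa> x * f_fun V K c x + g2_fun \<tau> \<kappa> x * h_fun V K c \<mu> x * y = G x + (A x + \<mu> * B x) * y"
    for \<mu> x y
    by (simp add: G_def A_def B_def f_def h_fun_def algebra_simps)
  have pos: "0 < u z" if "heteroclinic F G a b u w" for F u w z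
    using increasing_between_limits(2)[of u w a b z] that amb unfolding heteroclinic_def by fastforce
  have up_iff: "solves_S \<tau> \<kappa> V K c \<mu> u w \<and> (u \<longlongrightarrow> a) at_bot \<and> (u \<longlongrightarrow> b) at_top \<and>
      (w \<longlongrightarrow> 0) at_bot \<and> (w \<longlongrightarrow> 0) at_top \<and> (\<forall>z. w z > 0) \<longleftrightarrow>
      heteroclinic (\<lambda>x. A x + \<mu> * B x) G a b u w" for \<mu> u w
    using pos[of "\<lambda>x. A x + \<mu> * B x" u w] unfolding solves_S_def heteroclinic_def vf by blast
  have down_iff: "solves_S \<tau> \<kappa> V K c \<mu> u w \<and> (u \<longlongrightarrow> b) at_bot \<and> (u \<longlongrightarrow> a) at_top \<and>
      (w \<longlongrightarrow> 0) at_bot \<and> (w \<longlongrightarrow> 0) at_top \<and> (\<forall>z. w z < 0) \<longleftrightarrow>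
      heteroclinic (\<lambda>x. - A x + (- \<mu>) * B x) G a b (\<lambda>z. u (- z)) (\<lambda>z. - w (- z))"
    (is "?L \<longleftrightarrow> ?R") for \<mu> u w
  proof -
    have sgn: "G x - (- A x + - \<mu> * B x) * y = G x + (A x + \<mu> * B x) * y" for x y
      by (simp add: algebra_simps)
    have "0 < u z" if ?R for z using pos[OF that, of "- z"] by simp
    then show ?thesis unfolding heteroclinic_reversed_iff solves_S_def vf sgn by blast
  qed
  \<comment> \<open>Reversal is an involution, so quantifying over reversed pairs is quantifying over all pairs.\<close>
  have reverse: "(\<exists>u w. heteroclinic F G a b (\<lambda>z. u (- z)) (\<lambda>z. - w (- z))) \<longleftrightarrow>
      (\<exists>u w. heteroclinic F G a b u w)" for F
  proof
    assume "\<exists>u w. heteroclinic F G a b u w"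
    then obtain u w where "heteroclinic F G a b u w" by blast
    then show "\<exists>u w. heteroclinic F G a b (\<lambda>z. u (- z)) (\<lambda>z. - w (- z))"
      by (intro exI[of _ "\<lambda>z. u (- z)"] exI[of _ "\<lambda>z. - w (- z)"]) simp
  qed blast
  obtain \<mu>b where \<mu>b: "\<And>\<mu>. (\<exists>p. connection (\<lambda>u. A u + \<mu> * B u) G a b p) \<longleftrightarrow> \<mu> = \<mu>b"
    using unique_connection_parameter[OF amb(2,3) cA cB cG Bpos Gzero Gpos Gneg A' B' Ga Gm Gb] by auto
  obtain \<mu>f where \<mu>f: "\<And>\<mu>. (\<exists>p. connection (\<lambda>u. - A u + \<mu> * B u) G a b p) \<longleftrightarrow> \<mu> = \<mu>f"
    using unique_connection_parameter[OF amb(2,3) continuous_on_minus[OF cA] cB cG Bpos Gzero Gpos Gneg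
        DERIV_minus[OF A'] B' Ga Gm Gb] by auto
  have "(\<exists>u w. heteroclinic (\<lambda>x. A x + \<mu> * B x) G a b u w) \<longleftrightarrow> \<mu> = \<mu>b" for \<mu>
    by (simp only: orbit_iff[OF cF(1)] \<mu>b)
  moreover have "(\<exists>u w. heteroclinic (\<lambda>x. - A x + (- \<mu>) * B x) G a b u w) \<longleftrightarrow> \<mu> = - \<mu>f" for \<mu>
    by (simp only: orbit_iff[OF cF(2)] \<mu>f) auto
  ultimately show ?thesis unfolding ends up_iff down_iff reverse by blast
qed

end
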